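(* Let $p$ be a prime. If $G$ is a finite $p$-group with $\mathrm{cod}(G)=\{1,p,p^b,p^a\}$ where $2\le b<a$, then the nilpotence class of $G$ is at most $a+1$.
   Context: For an irreducible complex character $\chi$ of a finite group $G$, the codegree of $\chi$ is $\mathrm{cod}(\chi)=|G:\ker\chi|/\chi(1)$, and $\mathrm{cod}(G)$ denotes the set of codegrees of the irreducible characters of $G$. *)

theory Defs
  imports "Jordan_Normal_Form.Matrix" "HOL-Algebra.Generated_Groups"
begin

definition mat_trace :: "complex mat \<Rightarrow> complex" where
  "mat_trace A = (\<Sum>i<dim_row A. A $$ (i, i))"

text \<open>A complex representation of degree n of the group G: a homomorphism from G into
  the n x n complex matrices (the images are then automatically invertible).\<close>
definition is_rep :: "('a, 'b) monoid_scheme \<Rightarrow> nat \<Rightarrow> ('a \<Rightarrow> complex mat) \<Rightarrow> bool" where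
  "is_rep G n \<rho> \<longleftrightarrow>
     (\<forall>g \<in> carrier G. \<rho> g \<in> carrier_mat n n) \<and>
     \<rho> \<one>\<^bsub>G\<^esub> = 1\<^sub>m n \<and>
     (\<forall>g \<in> carrier G. \<forall>h \<in> carrier G. \<rho> (g \<otimes>\<^bsub>G\<^esub> h) = \<rho> g * \<rho> h)"

definition is_subspace :: "nat \<Rightarrow> complex vec set \<Rightarrow> bool" where
  "is_subspace n W \<longleftrightarrow> W \<subseteq> carrier_vec n \<and> 0\<^sub>v n \<in> W \<and>
     (\<forall>v \<in> W. \<forall>w \<in> W. v + w \<in> W) \<and> (\<forall>c. \<forall>v \<in> W. c \<cdot>\<^sub>v v \<in> W)"

definition irr_rep :: "('a, 'b) monoid_scheme \<Rightarrow> nat \<Rightarrow> ('a \<Rightarrow> complex mat) \<Rightarrow> bool" where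
  "irr_rep G n \<rho> \<longleftrightarrow> is_rep G n \<rho> \<and> n \<ge> 1 \<and>
     (\<forall>W. is_subspace n W \<and> (\<forall>g \<in> carrier G. \<forall>w \<in> W. \<rho> g *\<^sub>v w \<in> W)
          \<longrightarrow> W = {0\<^sub>v n} \<or> W = carrier_vec n)"

definition character :: "('a, 'b) monoid_scheme \<Rightarrow> ('a \<Rightarrow> complex mat) \<Rightarrow> 'a \<Rightarrow> complex" where
  "character G \<rho> = (\<lambda>g \<in> carrier G. mat_trace (\<rho> g))"

definition Irr :: "('a, 'b) monoid_scheme \<Rightarrow> ('a \<Rightarrow> complex) set" where
  "Irr G = {character G \<rho> | n \<rho>. irr_rep G n \<rho>}"

definition char_ker :: "('a, 'b) monoid_scheme \<Rightarrow> ('a \<Rightarrow> complex) \<Rightarrow> 'a set" where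
  "char_ker G \<chi> = {g \<in> carrier G. \<chi> g = \<chi> \<one>\<^bsub>G\<^esub>}"

text \<open>Codegree cod(chi) = |G : ker chi| / chi(1).  Here chi(1) is a positive integer
  (the degree), so we take its real part.\<close>
definition codegree :: "('a, 'b) monoid_scheme \<Rightarrow> ('a \<Rightarrow> complex) \<Rightarrow> real" where
  "codegree G \<chi> = (real (card (carrier G)) / real (card (char_ker G \<chi>))) / Re (\<chi> \<one>\<^bsub>G\<^esub>)"

definition cod :: "('a, 'b) monoid_scheme \<Rightarrow> real set" where
  "cod G = codegree G ` Irr G"

definition p_group :: "nat \<Rightarrow> ('a, 'b) monoid_scheme \<Rightarrow> bool" where
  "p_group p G \<longleftrightarrow> group G \<and> finite (carrier G) \<and> (\<exists>k. card (carrier G) = p ^ k)"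

definition comm_subgroup :: "('a, 'b) monoid_scheme \<Rightarrow> 'a set \<Rightarrow> 'a set \<Rightarrow> 'a set" where
  "comm_subgroup G H K = generate G
     {h \<otimes>\<^bsub>G\<^esub> k \<otimes>\<^bsub>G\<^esub> inv\<^bsub>G\<^esub> h \<otimes>\<^bsub>G\<^esub> inv\<^bsub>G\<^esub> k | h k. h \<in> H \<and> k \<in> K}"

text \<open>Lower central series, indexed from 0: lcs 0 = G (= gamma_1), lcs (i+1) = [lcs i, G].\<close>
fun lcs :: "('a, 'b) monoid_scheme \<Rightarrow> nat \<Rightarrow> 'a set" where
  "lcs G 0 = carrier G"
| "lcs G (Suc i) = comm_subgroup G (lcs G i) (carrier G)"

text \<open>Nilpotence class: the least c with gamma_(c+1) = 1, i.e. lcs G c = {1}.\<close>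
definition nilpotence_class :: "('a, 'b) monoid_scheme \<Rightarrow> nat" where
  "nilpotence_class G = (LEAST c. lcs G c = {\<one>\<^bsub>G\<^esub>})"

end

theory Submission
  imports Defs "Jordan_Normal_Form.Spectral_Radius" "Jordan_Normal_Form.Schur_Decomposition"
    "HOL-Algebra.Group_Action" "HOL-Algebra.Multiplicative_Group"
begin

text \<open>Since the kernels of the irreducible representations intersect trivially, it is enough to
  bound the class of \<open>G / K\<close> for \<open>K\<close> such a kernel; write \<open>L\<^sub>i\<close> for the lower central
  series of \<open>G\<close> modulo \<open>K\<close>, starting at \<open>L\<^sub>0 = G\<close>. From \<open>n\<^sup>2 |Z(\<rho>)| \<le> |G|\<close> one gets
  \<open>|G : K| \<le> p^(2a - 1)\<close>. A \<open>p\<close>-group of class at least 3 cannot have all its codegrees in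
  \<open>{1, p, p^b}\<close>, so if \<open>L\<^sub>2 \<noteq> K\<close> there is an irreducible representation of degree \<open>d\<close>
  and codegree \<open>p^a\<close> whose kernel contains \<open>L\<^sub>3\<close>, whence \<open>|G : L\<^sub>3| \<ge> p^a d\<close>. If
  \<open>d \<ge> p\<close> this leaves \<open>|L\<^sub>3 : K| \<le> p^(a - 2)\<close>; if \<open>d = 1\<close> the kernel contains \<open>L\<^sub>1\<close> and
  \<open>|L\<^sub>1 : K| \<le> p^(a - 1)\<close>. The series drops by at least a factor \<open>p\<close> in every step, so it
  reaches \<open>K\<close> after at most \<open>a + 1\<close> steps.

  For the claim about three codegrees, take \<open>\<chi>\<close> of class 3 with kernel \<open>K\<close> and center \<open>Z\<close>, and
  a nonlinear \<open>\<psi>\<close> with kernel \<open>D \<supseteq> Z\<close> and center \<open>Y\<close>. As \<open>\<psi>\<close> has class 2, it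
  vanishes off \<open>Y\<close>, and comparing orders gives \<open>|Z| |D|\<^sup>2 \<le> |K|\<^sup>2 |Y|\<close>. Elementary exponent
  bounds give \<open>|Y : D| \<le> p\<^sup>2\<close>, which forces \<open>D = Z\<close> and \<open>|Z : K| = p\<close>; then \<open>Y / D\<close> has
  exponent \<open>p\<close>, so \<open>|Y : D| \<le> p\<close>, a contradiction.\<close>

section \<open>Complex matrices of finite order and invariant subspaces\<close>

lemma upper_triangular_diag_pow:
  fixes B :: "'a :: comm_ring_1 mat"
  assumes B: "B \<in> carrier_mat n n" and ut: "upper_triangular B"
  shows "upper_triangular (B ^\<^sub>m k) \<and> (\<forall>i<n. (B ^\<^sub>m k) $$ (i, i) = (B $$ (i, i)) ^ k)"
proof (induction k)
  case 0
  show ?case using B by auto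
next
  case (Suc k)
  let ?C = "B ^\<^sub>m k"
  have C: "?C \<in> carrier_mat n n" using B by auto
  have entry: "(?C * B) $$ (i, j) = (\<Sum>l\<in>{0..<n}. ?C $$ (i, l) * B $$ (l, j))"
    if "i < n" "j < n" for i j
    using that B C by (auto simp: scalar_prod_def)
  have zC: "?C $$ (i, l) = 0" if "l < i" "i < n" for i l
    using Suc that C by (auto dest: upper_triangularD)
  have zB: "B $$ (i, l) = 0" if "l < i" "i < n" for i l
    using ut that B by (auto dest: upper_triangularD)
  have "(?C * B) $$ (i, j) = 0" if "j < i" "i < n" for i j
  proof -
    have "?C $$ (i, l) * B $$ (l, j) = 0" if "l < n" for l
      using zC[of l i] zB[of j l] \<open>j < i\<close> \<open>i < n\<close> that by (cases "l < i") auto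
    then show ?thesis using that by (subst entry) auto
  qed
  moreover have "(?C * B) $$ (i, i) = B $$ (i, i) ^ Suc k" if "i < n" for i
  proof -
    have "?C $$ (i, l) * B $$ (l, i) = 0" if "l \<in> {0..<n} - {i}" for l
      using zC[of l i] zB[of i l] \<open>i < n\<close> that by (cases "l < i") auto
    then have "(?C * B) $$ (i, i) = ?C $$ (i, i) * B $$ (i, i)"
      using that by (subst entry) (auto simp: sum.remove[of _ i])
    then show ?thesis using Suc that by simp
  qed
  ultimately show ?case using B C by (auto intro!: upper_triangularI)
qed

text \<open>Induction on the distance \<open>d\<close> from the diagonal: once the nearer
  superdiagonals vanish, the entry of \<open>B ^\<^sub>m k\<close> at distance \<open>d\<close> is
  \<open>k\<close> times that of \<open>B\<close>. For \<open>k = m\<close> it is zero, and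
  characteristic zero kills the entry of \<open>B\<close>. Together with triangularization this
  replaces the diagonalizability of matrices of finite order.\<close>

lemma unipotent_finite_order:
  fixes B :: "'a :: {comm_ring_1, ring_char_0, semiring_no_zero_divisors} mat"
  assumes B: "B \<in> carrier_mat n n" and ut: "upper_triangular B"
    and diag: "\<And>i. i < n \<Longrightarrow> B $$ (i, i) = 1"
    and m: "m > 0" and pow: "B ^\<^sub>m m = 1\<^sub>m n"
  shows "B = 1\<^sub>m n"
proof -
  have sup: "B $$ (i, i + d) = 0" if "d > 0" "i + d < n" for d i
    using that
  proof (induction d arbitrary: i rule: less_induct)
    case (less d)
    \<comment> \<open>A row \<open>l\<close> strictly between \<open>i\<close> and
      \<open>i + d\<close> has distance \<open>i + d - l < d\<close> in this column, so the
      induction hypothesis applies; the rows further down are covered by triangularity.\<close>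
    have zB: "B $$ (l, i + d) = 0" if "i < l" "l < n" "l \<noteq> i + d" for l
    proof (cases "l < i + d")
      case True
      with less.IH[of "i + d - l" l] less.prems that show ?thesis by auto
    next
      case False
      with that ut B show ?thesis by (auto dest: upper_triangularD)
    qed
    have "(B ^\<^sub>m k) $$ (i, i + d) = of_nat k * B $$ (i, i + d)" for k
    proof (induction k)
      case 0
      show ?case using less.prems B by auto
    next
      case (Suc k)
      let ?C = "B ^\<^sub>m k"
      have C: "?C \<in> carrier_mat n n" using B by auto
      have uC: "upper_triangular ?C" and dC: "?C $$ (l, l) = 1" if "l < n" for l
        using upper_triangular_diag_pow[OF B ut, of k] diag that by auto
      have i: "i < n" using less.prems by auto
      have "?C $$ (i, l) * B $$ (l, i + d) = 0" if "l \<in> {0..<n} - {i} - {i + d}" for l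
        using zB[of l] upper_triangularD[OF uC[OF i], of l i] C i that by (cases "l < i") auto
      then have "(\<Sum>l\<in>{0..<n} - {i} - {i + d}. ?C $$ (i, l) * B $$ (l, i + d)) = 0"
        by (rule sum.neutral[OF ballI])
      then have "(?C * B) $$ (i, i + d) = ?C $$ (i, i) * B $$ (i, i + d)
          + ?C $$ (i, i + d) * B $$ (i + d, i + d)"
        using less.prems B C
        by (auto simp: scalar_prod_def sum.remove[of _ i] sum.remove[of _ "i + d"])
      then show ?case
        using Suc.IH dC[OF i] diag[OF less.prems(2)] by (simp add: algebra_simps)
    qed
    from this[of m] show ?case using pow m less.prems by auto
  qed
  show ?thesis
  proof (rule eq_matI)
    fix i j assume "i < dim_row (1\<^sub>m n :: 'a mat)" "j < dim_col (1\<^sub>m n :: 'a mat)"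
    then have ij: "i < n" "j < n" by auto
    consider "i = j" | "i < j" | "j < i" by linarith
    then show "B $$ (i, j) = 1\<^sub>m n $$ (i, j)"
    proof cases
      case 2
      then show ?thesis using sup[of "j - i" i] ij by auto
    qed (use ij diag ut B in \<open>auto dest: upper_triangularD\<close>)
  qed (use B in auto)
qed

lemma mat_trace_mult_comm:
  assumes "A \<in> carrier_mat n m" "B \<in> carrier_mat m n"
  shows "mat_trace (A * B) = mat_trace (B * A)"
proof -
  have "mat_trace (A * B) = (\<Sum>i<n. \<Sum>l<m. A $$ (i, l) * B $$ (l, i))"
    using assms by (auto simp: mat_trace_def scalar_prod_def atLeast0LessThan)
  also have "\<dots> = (\<Sum>l<m. \<Sum>i<n. B $$ (l, i) * A $$ (i, l))"
    by (subst sum.swap) (simp add: mult.commute)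
  also have "\<dots> = mat_trace (B * A)"
    using assms by (auto simp: mat_trace_def scalar_prod_def atLeast0LessThan)
  finally show ?thesis .
qed

lemma mat_trace_similar:
  assumes A: "A \<in> carrier_mat n n" and sim: "similar_mat_wit A B P Q"
  shows "mat_trace A = mat_trace B"
proof -
  note w = similar_mat_witD2[OF A sim]
  have "mat_trace A = mat_trace (P * (B * Q))"
    using w by (simp add: assoc_mult_mat[of _ n n _ n _ n])
  also have "\<dots> = mat_trace (B * Q * P)"
    using w by (intro mat_trace_mult_comm) auto
  also have "B * Q * P = B"
    using w by (simp add: assoc_mult_mat[of _ n n _ n _ n])
  finally show ?thesis .
qed

lemma complex_triangularizable:
  fixes A :: "complex mat"
  assumes A: "A \<in> carrier_mat n n"
  obtains B P Q where "similar_mat_wit A B P Q" "B \<in> carrier_mat n n" "upper_triangular B"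
proof -
  obtain es where "char_poly A = (\<Prod>a\<leftarrow>es. [:- a, 1:])"
    using char_poly_factorized[OF A] by auto
  then obtain B where "B \<in> carrier_mat n n" "upper_triangular B" "similar_mat A B"
    using schur_decomposition_exists[OF A] by blast
  then show thesis using that unfolding similar_mat_def by blast
qed

lemma root_of_unity_norm:
  fixes z :: complex
  assumes "z ^ m = 1" "m > 0"
  shows "norm z = 1"
  using assms power_eq_1_iff by blast

lemma finite_order_triangularize:
  fixes A :: "complex mat"
  assumes A: "A \<in> carrier_mat n n" and m: "m > 0" and pow: "A ^\<^sub>m m = 1\<^sub>m n"
  obtains B P Q where "similar_mat_wit A B P Q" "B \<in> carrier_mat n n" "upper_triangular B"
    "B ^\<^sub>m m = 1\<^sub>m n" "\<And>i. i < n \<Longrightarrow> B $$ (i, i) ^ m = 1"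
proof -
  obtain B P Q where sim: "similar_mat_wit A B P Q"
    and B: "B \<in> carrier_mat n n" and ut: "upper_triangular B"
    by (rule complex_triangularizable[OF A])
  have "similar_mat_wit (B ^\<^sub>m m) (A ^\<^sub>m m) Q P"
    using similar_mat_wit_pow[OF similar_mat_wit_sym[OF sim]] .
  then have "B ^\<^sub>m m = Q * 1\<^sub>m n * P" and "Q * P = 1\<^sub>m n"
    using similar_mat_witD2[of "B ^\<^sub>m m" n n "A ^\<^sub>m m" Q P] B pow by auto
  moreover have "Q \<in> carrier_mat n n" using similar_mat_witD2[OF A sim] by auto
  ultimately have Bm: "B ^\<^sub>m m = 1\<^sub>m n" by auto
  then have "B $$ (i, i) ^ m = 1" if "i < n" for i
    using upper_triangular_diag_pow[OF B ut, of m] that by auto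
  then show thesis using that sim B ut Bm by blast
qed

text \<open>\<open>A ^\<^sub>m (m - 1)\<close> is the inverse of \<open>A\<close>, and its
  eigenvalues are inverses of roots of unity, hence their conjugates. This gives the character value
  at an inverse element.\<close>

lemma trace_pow_pred:
  fixes A :: "complex mat"
  assumes A: "A \<in> carrier_mat n n" and m: "m > 0" and pow: "A ^\<^sub>m m = 1\<^sub>m n"
  shows "mat_trace (A ^\<^sub>m (m - 1)) = cnj (mat_trace A)"
proof -
  obtain B P Q where sim: "similar_mat_wit A B P Q" and B: "B \<in> carrier_mat n n"
    and ut: "upper_triangular B" and rt: "\<And>i. i < n \<Longrightarrow> B $$ (i, i) ^ m = 1"
    by (rule finite_order_triangularize[OF A m pow]) blast
  have inv: "z ^ (m - 1) = cnj z" if "z ^ m = 1" for z :: complex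
  proof -
    have "z * cnj z = 1"
      using root_of_unity_norm[OF that m] by (simp add: complex_norm_square[symmetric])
    moreover have "z * z ^ (m - 1) = 1" using that m by (simp add: power_eq_if)
    ultimately show ?thesis by (metis mult_cancel_left mult_zero_left zero_neq_one)
  qed
  have "mat_trace (A ^\<^sub>m (m - 1)) = mat_trace (B ^\<^sub>m (m - 1))"
    by (intro mat_trace_similar[of _ n, OF _ similar_mat_wit_pow[OF sim]] pow_carrier_mat[OF A])
  also have "\<dots> = (\<Sum>i<n. B $$ (i, i) ^ (m - 1))"
    using upper_triangular_diag_pow[OF B ut, of "m - 1"] B by (auto simp: mat_trace_def)
  also have "\<dots> = cnj (mat_trace B)"
    using B rt inv by (auto simp: mat_trace_def intro!: sum.cong)
  also have "mat_trace B = mat_trace A" using mat_trace_similar[OF A sim] by simp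
  finally show ?thesis .
qed

text \<open>The eigenvalues lie on the unit circle, so their real parts are at most 1; if they sum
  to \<open>n\<close>, each eigenvalue is 1, and a unipotent matrix of finite order is the identity.
  This is how kernels are read off from traces.\<close>

lemma finite_order_trace_eq_dim:
  fixes A :: "complex mat"
  assumes A: "A \<in> carrier_mat n n" and m: "m > 0" and pow: "A ^\<^sub>m m = 1\<^sub>m n"
    and tr: "mat_trace A = of_nat n"
  shows "A = 1\<^sub>m n"
proof -
  obtain B P Q where sim: "similar_mat_wit A B P Q" and B: "B \<in> carrier_mat n n"
    and ut: "upper_triangular B" and Bm: "B ^\<^sub>m m = 1\<^sub>m n"
    and rt: "\<And>i. i < n \<Longrightarrow> B $$ (i, i) ^ m = 1"
    by (rule finite_order_triangularize[OF A m pow]) blast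
  have nrm: "norm (B $$ (i, i)) = 1" if "i < n" for i
    using root_of_unity_norm[OF rt[OF that] m] .
  have "mat_trace B = of_nat n" using mat_trace_similar[OF A sim] tr by simp
  then have "Re (\<Sum>i<n. B $$ (i, i)) = real n"
    using B by (simp add: mat_trace_def)
  then have "(\<Sum>i<n. 1 - Re (B $$ (i, i))) = 0"
    by (simp add: sum_subtractf)
  moreover have "0 \<le> 1 - Re (B $$ (i, i))" if "i < n" for i
    using complex_Re_le_cmod[of "B $$ (i, i)"] nrm[OF that] by simp
  ultimately have "1 - Re (B $$ (i, i)) = 0" if "i < n" for i
    using that by (subst (asm) sum_nonneg_eq_0_iff) auto
  then have "B $$ (i, i) = 1" if "i < n" for i
    using nrm[OF that] that by (auto simp: complex_eq_iff cmod_def)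
  then have "B = 1\<^sub>m n" using unipotent_finite_order[OF B ut _ m Bm] by blast
  then show ?thesis using similar_mat_witD2[OF A sim] by auto
qed

section \<open>Bases adapted to a subspace\<close>

lemma is_subspace_sum:
  fixes k :: nat
  assumes W: "is_subspace n W" and f: "\<And>j. j < k \<Longrightarrow> f j \<in> W"
  shows "vec n (\<lambda>i. \<Sum>j<k. c j * f j $ i) \<in> W"
  using f
proof (induction k)
  case 0
  then show ?case using W by (auto simp: is_subspace_def zero_vec_def)
next
  case (Suc k)
  have dim: "f j \<in> carrier_vec n" if "j < Suc k" for j
    using Suc.prems[OF that] W by (auto simp: is_subspace_def)
  have "vec n (\<lambda>i. \<Sum>j<Suc k. c j * f j $ i)
      = vec n (\<lambda>i. \<Sum>j<k. c j * f j $ i) + c k \<cdot>\<^sub>v f k"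
    using dim[of k] by (intro eq_vecI) auto
  then show ?case using Suc W by (auto simp: is_subspace_def)
qed

text \<open>An invertible matrix with a maximal number of initial columns in \<open>W\<close>; if some vector
  of \<open>W\<close> had a further nonzero coordinate, Cramer's rule would allow exchanging a column.\<close>
lemma subspace_adapted_basis:
  assumes W: "is_subspace n W"
  obtains P Q k where "P \<in> carrier_mat n n" "Q \<in> carrier_mat n n" "P * Q = 1\<^sub>m n" "Q * P = 1\<^sub>m n"
    "k \<le> n" "\<And>j. j < k \<Longrightarrow> col P j \<in> W"
    "\<And>w i. w \<in> W \<Longrightarrow> k \<le> i \<Longrightarrow> i < n \<Longrightarrow> (Q *\<^sub>v w) $ i = 0"
proof -
  define good where "good k \<longleftrightarrow> k \<le> n \<and> (\<exists>P \<in> carrier_mat n n. det P \<noteq> 0 \<and> (\<forall>j<k. col P j \<in> W))" for k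
  have "good 0" unfolding good_def by (auto intro!: bexI[of _ "1\<^sub>m n"])
  moreover have bnd: "\<forall>k. good k \<longrightarrow> k \<le> n" by (auto simp: good_def)
  ultimately obtain k where k: "good k" and max: "\<And>l. good l \<Longrightarrow> l \<le> k"
    using Nat.ex_has_greatest_nat[of good 0 n] by blast
  then obtain P where P: "P \<in> carrier_mat n n" and dP: "det P \<noteq> 0" and cW: "\<And>j. j < k \<Longrightarrow> col P j \<in> W"
    and kn: "k \<le> n"
    unfolding good_def by auto
  obtain Q where Q: "Q \<in> carrier_mat n n" "P * Q = 1\<^sub>m n" "Q * P = 1\<^sub>m n"
    using det_non_zero_imp_unit[OF P dP, of undefined] by (auto simp: Units_def ring_mat_def)
  have "(Q *\<^sub>v w) $ j = 0" if w: "w \<in> W" and j: "k \<le> j" "j < n" for w j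
  proof (rule ccontr)
    assume nz: "(Q *\<^sub>v w) $ j \<noteq> 0"
    have wc: "w \<in> carrier_vec n" using w W by (auto simp: is_subspace_def)
    have "P *\<^sub>v (Q *\<^sub>v w) = w"
      using P Q wc by (simp add: assoc_mult_mat_vec[of _ n n _ n, symmetric])
    then have d: "det (replace_col P w j) \<noteq> 0"
      using cramer_lemma_mat[OF P, of "Q *\<^sub>v w" j] nz dP Q j wc by auto
    let ?R = "replace_col P w j"
    have R: "?R \<in> carrier_mat n n" using P by (auto simp: replace_col_def)
    \<comment> \<open>The replacement puts \<open>w\<close> at position \<open>j \<ge> k\<close>;
      the swap moves it to position \<open>k\<close>, directly behind the \<open>k\<close> columns
      already in \<open>W\<close>. For \<open>j = k\<close> it is there already.\<close>
    define S where "S = (if k = j then ?R else mat_swapcols k j ?R)"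
    have S: "S \<in> carrier_mat n n" using R by (auto simp: S_def mat_swapcols_def)
    have "det S \<noteq> 0" using d det_swapcols[OF _ _ _ R, of k j] j by (auto simp: S_def)
    moreover have "col S i \<in> W" if "i < Suc k" for i
    proof (cases "i = k")
      case True
      then have "col S i = w" using j P wc
        by (intro eq_vecI) (auto simp: S_def replace_col_def mat_swapcols_def)
      then show ?thesis using w by simp
    next
      case False
      then have "col S i = col P i" using j P that
        by (intro eq_vecI) (auto simp: S_def replace_col_def mat_swapcols_def)
      then show ?thesis using cW False that by simp
    qed
    ultimately have "good (Suc k)" using S j unfolding good_def by (auto intro!: bexI[of _ S])
    then show False using max[of "Suc k"] by simp
  qed
  then show thesis using that P Q kn cW by blast
qed

section \<open>Representations and Schur's lemma\<close>

text \<open>Same convention as in the generators of \<open>comm_subgroup\<close>, so that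
  \<open>lcs\<close> and \<open>rel_lcs\<close> can be compared.\<close>

definition commutator :: "('a, 'b) monoid_scheme \<Rightarrow> 'a \<Rightarrow> 'a \<Rightarrow> 'a" where
  "commutator G g h = g \<otimes>\<^bsub>G\<^esub> h \<otimes>\<^bsub>G\<^esub> inv\<^bsub>G\<^esub> g \<otimes>\<^bsub>G\<^esub> inv\<^bsub>G\<^esub> h"

definition rep_ker :: "('a, 'b) monoid_scheme \<Rightarrow> nat \<Rightarrow> ('a \<Rightarrow> complex mat) \<Rightarrow> 'a set" where
  "rep_ker G n \<rho> = {g \<in> carrier G. \<rho> g = 1\<^sub>m n}"

text \<open>The center of the character: for irreducible \<open>\<rho>\<close> it is the preimage of
  the center of the group modulo the kernel, see \<open>rep_center_iff\<close>.\<close>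

definition rep_center :: "('a, 'b) monoid_scheme \<Rightarrow> nat \<Rightarrow> ('a \<Rightarrow> complex mat) \<Rightarrow> 'a set" where
  "rep_center G n \<rho> = {g \<in> carrier G. \<exists>c. \<rho> g = c \<cdot>\<^sub>m 1\<^sub>m n}"

locale fin_group = group G for G (structure) +
  assumes fin: "finite (carrier G)"

lemma irr_rep_is_rep: "irr_rep G n \<rho> \<Longrightarrow> is_rep G n \<rho>"
  by (simp add: irr_rep_def)

lemma irr_rep_pos: "irr_rep G n \<rho> \<Longrightarrow> n > 0"
  by (simp add: irr_rep_def)

lemma smult_one_mat_mult:
  fixes A :: "'a :: comm_ring_1 mat"
  assumes "A \<in> carrier_mat n n"
  shows "(c \<cdot>\<^sub>m 1\<^sub>m n) * A = c \<cdot>\<^sub>m A" "A * (c \<cdot>\<^sub>m 1\<^sub>m n) = c \<cdot>\<^sub>m A"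
  using assms by auto

lemma smult_mat_eq_one_iff:
  "n > 0 \<Longrightarrow> c \<cdot>\<^sub>m 1\<^sub>m n = (1\<^sub>m n :: 'a :: comm_ring_1 mat) \<longleftrightarrow> c = 1"
proof
  assume "n > 0" "c \<cdot>\<^sub>m 1\<^sub>m n = (1\<^sub>m n :: 'a mat)"
  then have "(c \<cdot>\<^sub>m 1\<^sub>m n) $$ (0, 0) = (1\<^sub>m n :: 'a mat) $$ (0, 0)" by simp
  then show "c = 1" using \<open>n > 0\<close> by simp
qed auto

lemma mat_trace_smult_one: "mat_trace (c \<cdot>\<^sub>m 1\<^sub>m n) = c * of_nat n"
  by (simp add: mat_trace_def)

lemma mat_trace_one: "mat_trace (1\<^sub>m n) = of_nat n"
  by (simp add: mat_trace_def)

context group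
begin

lemma commutator_closed [simp]:
  "g \<in> carrier G \<Longrightarrow> h \<in> carrier G \<Longrightarrow> commutator G g h \<in> carrier G"
  by (simp add: commutator_def)

lemma commutator_mult:
  assumes "g \<in> carrier G" "h \<in> carrier G"
  shows "commutator G g h \<otimes> (h \<otimes> g) = g \<otimes> h"
proof -
  have "inv h \<otimes> (h \<otimes> g) = g" using assms by (simp add: m_assoc[symmetric])
  then show ?thesis using assms by (simp add: commutator_def m_assoc)
qed

lemma conj_commutator:
  assumes x: "x \<in> carrier G" and g: "g \<in> carrier G" and h: "h \<in> carrier G"
  shows "x \<otimes> commutator G g h \<otimes> inv x = commutator G (x \<otimes> g \<otimes> inv x) (x \<otimes> h \<otimes> inv x)"
proof -
  have c: "inv x \<otimes> (x \<otimes> y) = y" if "y \<in> carrier G" for y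
    using x that by (simp add: m_assoc[symmetric])
  show ?thesis using x g h by (simp add: commutator_def m_assoc inv_mult_group c)
qed

context
  fixes n \<rho>
  assumes rep: "is_rep G n \<rho>"
begin

lemma rep_carrier: "g \<in> carrier G \<Longrightarrow> \<rho> g \<in> carrier_mat n n"
  and rep_one: "\<rho> \<one> = 1\<^sub>m n"
  and rep_mult: "g \<in> carrier G \<Longrightarrow> h \<in> carrier G \<Longrightarrow> \<rho> (g \<otimes> h) = \<rho> g * \<rho> h"
  using rep by (auto simp: is_rep_def)

lemma rep_inv:
  assumes "g \<in> carrier G"
  shows "\<rho> g * \<rho> (inv g) = 1\<^sub>m n" "\<rho> (inv g) * \<rho> g = 1\<^sub>m n"
  using assms rep_mult[of g "inv g"] rep_mult[of "inv g" g] rep_one by auto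

lemma rep_pow: "g \<in> carrier G \<Longrightarrow> \<rho> (g [^] (k::nat)) = \<rho> g ^\<^sub>m k"
  using rep_carrier[of g] by (induction k) (auto simp: rep_one rep_mult)

lemma rep_commutator:
  assumes g: "g \<in> carrier G" and h: "h \<in> carrier G"
  shows "\<rho> g * \<rho> h = \<rho> (commutator G g h) * (\<rho> h * \<rho> g)"
  using commutator_mult[OF g h] g h by (metis commutator_closed m_closed rep_mult)

lemma rep_ker_normal: "rep_ker G n \<rho> \<lhd> G"
proof (rule normal_invI)
  show "subgroup (rep_ker G n \<rho>) G"
  proof (rule subgroupI)
    fix a assume a: "a \<in> rep_ker G n \<rho>"
    then have "\<rho> (inv a) = 1\<^sub>m n"
      using rep_inv[of a] rep_carrier[of "inv a"] by (auto simp: rep_ker_def)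
    then show "inv a \<in> rep_ker G n \<rho>" using a by (auto simp: rep_ker_def)
  qed (auto simp: rep_ker_def rep_mult rep_one)
  show "x \<otimes> h \<otimes> inv x \<in> rep_ker G n \<rho>" if "x \<in> carrier G" "h \<in> rep_ker G n \<rho>" for x h
    using that rep_carrier[of x] rep_inv[of x] by (auto simp: rep_ker_def rep_mult)
qed

lemma rep_center_normal: "rep_center G n \<rho> \<lhd> G"
proof (rule normal_invI)
  show "subgroup (rep_center G n \<rho>) G"
  proof (rule subgroupI)
    fix a assume a: "a \<in> rep_center G n \<rho>"
    then obtain c where ac: "a \<in> carrier G" and c: "\<rho> a = c \<cdot>\<^sub>m 1\<^sub>m n" by (auto simp: rep_center_def)
    have I: "\<rho> (inv a) \<in> carrier_mat n n" using rep_carrier ac by simp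
    have "c \<cdot>\<^sub>m \<rho> (inv a) = 1\<^sub>m n"
      using rep_inv(1)[OF ac] smult_one_mat_mult(1)[OF I, of c] by (simp add: c)
    then have "inverse c \<cdot>\<^sub>m (c \<cdot>\<^sub>m \<rho> (inv a)) = inverse c \<cdot>\<^sub>m 1\<^sub>m n" by simp
    moreover have "inverse c \<cdot>\<^sub>m (c \<cdot>\<^sub>m \<rho> (inv a)) = \<rho> (inv a)"
    \<comment> \<open>\<open>is_rep\<close> allows degree 0, where the scalar \<open>c\<close> may
      be zero; both sides are then empty matrices.\<close>
    proof (cases "n = 0")
      case True
      then show ?thesis using I by (intro eq_matI) auto
    next
      case False
      then have "c \<noteq> 0" using \<open>c \<cdot>\<^sub>m \<rho> (inv a) = 1\<^sub>m n\<close> I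
        by (metis index_one_mat(1) index_smult_mat(1) carrier_matD mult_zero_left neq0_conv zero_neq_one)
      then show ?thesis using I by (intro eq_matI) auto
    qed
    ultimately show "inv a \<in> rep_center G n \<rho>" using ac by (auto simp: rep_center_def)
  next
    fix a b assume "a \<in> rep_center G n \<rho>" "b \<in> rep_center G n \<rho>"
    then obtain c d where cd: "a \<in> carrier G" "b \<in> carrier G" "\<rho> a = c \<cdot>\<^sub>m 1\<^sub>m n" "\<rho> b = d \<cdot>\<^sub>m 1\<^sub>m n"
      by (auto simp: rep_center_def)
    then have "\<rho> (a \<otimes> b) = (c * d) \<cdot>\<^sub>m 1\<^sub>m n" by (auto simp: rep_mult intro!: eq_matI)
    then show "a \<otimes> b \<in> rep_center G n \<rho>" using cd by (auto simp: rep_center_def)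
  next
    have "\<rho> \<one> = 1 \<cdot>\<^sub>m 1\<^sub>m n" using rep_one by auto
    then show "rep_center G n \<rho> \<noteq> {}" unfolding rep_center_def by blast
  qed (auto simp: rep_center_def)
  show "x \<otimes> h \<otimes> inv x \<in> rep_center G n \<rho>" if x: "x \<in> carrier G" and h: "h \<in> rep_center G n \<rho>" for x h
  proof -
    obtain c where hc: "h \<in> carrier G" and c: "\<rho> h = c \<cdot>\<^sub>m 1\<^sub>m n" using h by (auto simp: rep_center_def)
    have "\<rho> (x \<otimes> h \<otimes> inv x) = c \<cdot>\<^sub>m (\<rho> x * \<rho> (inv x))"
      using x hc rep_carrier[of x] rep_carrier[of "inv x"]
      by (simp add: rep_mult c smult_one_mat_mult mult_smult_assoc_mat[of _ n n _ n])
    then show ?thesis using x hc rep_inv by (auto simp: rep_center_def)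
  qed
qed

lemma rep_ker_subset_center: "rep_ker G n \<rho> \<subseteq> rep_center G n \<rho>"
proof
  fix g assume "g \<in> rep_ker G n \<rho>"
  moreover from this have "\<rho> g = 1 \<cdot>\<^sub>m 1\<^sub>m n" by (auto simp: rep_ker_def)
  ultimately show "g \<in> rep_center G n \<rho>" unfolding rep_ker_def rep_center_def by blast
qed

lemma commutator_in_ker_iff:
  assumes g: "g \<in> carrier G" and h: "h \<in> carrier G"
  shows "commutator G g h \<in> rep_ker G n \<rho> \<longleftrightarrow> \<rho> g * \<rho> h = \<rho> h * \<rho> g"
proof
  assume "commutator G g h \<in> rep_ker G n \<rho>"
  then show "\<rho> g * \<rho> h = \<rho> h * \<rho> g"
    using rep_commutator[OF g h] rep_carrier[OF g] rep_carrier[OF h] by (auto simp: rep_ker_def)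
next
  assume eq: "\<rho> g * \<rho> h = \<rho> h * \<rho> g"
  have "\<rho> (commutator G g h) = \<rho> (g \<otimes> h) * \<rho> (inv (h \<otimes> g))"
    using g h by (simp add: commutator_def rep_mult[symmetric] m_assoc inv_mult_group)
  also have "\<rho> (g \<otimes> h) = \<rho> (h \<otimes> g)" using g h eq by (simp add: rep_mult)
  also have "\<rho> (h \<otimes> g) * \<rho> (inv (h \<otimes> g)) = 1\<^sub>m n" using g h by (intro rep_inv) auto
  finally show "commutator G g h \<in> rep_ker G n \<rho>" using g h by (simp add: rep_ker_def)
qed

lemma rep_center_commutator:
  assumes "g \<in> rep_center G n \<rho>" "h \<in> carrier G"
  shows "commutator G g h \<in> rep_ker G n \<rho>"
  using assms commutator_in_ker_iff[of g h] rep_carrier[of h]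
  by (auto simp: rep_center_def smult_one_mat_mult)

end

text \<open>Schur's lemma: an eigenspace of a commuting matrix is invariant.\<close>
lemma schur_scalar:
  assumes irr: "irr_rep G n \<rho>" and A: "A \<in> carrier_mat n n"
    and comm: "\<And>g. g \<in> carrier G \<Longrightarrow> A * \<rho> g = \<rho> g * A"
  obtains c where "A = c \<cdot>\<^sub>m 1\<^sub>m n"
proof -
  have rep: "is_rep G n \<rho>" and n: "n > 0" using irr irr_rep_is_rep irr_rep_pos by auto
  obtain c v where v: "eigenvector A v c"
    using spectrum_non_empty[OF A n] by (auto simp: spectrum_def eigenvalue_def)
  define W where "W = {w \<in> carrier_vec n. A *\<^sub>v w = c \<cdot>\<^sub>v w}"
  have sub: "is_subspace n W"
    using A by (auto simp: is_subspace_def W_def mult_add_distrib_mat_vec[OF A] smult_add_distrib_vec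
        mult_mat_vec[OF A] smult_smult_assoc mult.commute)
  moreover have "\<rho> g *\<^sub>v w \<in> W" if "g \<in> carrier G" "w \<in> W" for g w
  proof -
    have R: "\<rho> g \<in> carrier_mat n n" using rep_carrier[OF rep] that by simp
    have w: "w \<in> carrier_vec n" "A *\<^sub>v w = c \<cdot>\<^sub>v w" using that by (auto simp: W_def)
    have "A *\<^sub>v (\<rho> g *\<^sub>v w) = (A * \<rho> g) *\<^sub>v w"
      using A R w by (simp add: assoc_mult_mat_vec)
    also have "\<dots> = \<rho> g *\<^sub>v (A *\<^sub>v w)"
      using comm[OF that(1)] A R w by (simp add: assoc_mult_mat_vec)
    also have "\<dots> = c \<cdot>\<^sub>v (\<rho> g *\<^sub>v w)"
      using w R by (simp add: mult_mat_vec)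
    finally show ?thesis using R w by (simp add: W_def)
  qed
  moreover have "W \<noteq> {0\<^sub>v n}" using v A by (auto simp: eigenvector_def W_def)
  ultimately have W: "W = carrier_vec n" using irr unfolding irr_rep_def by blast
  have "A = c \<cdot>\<^sub>m 1\<^sub>m n"
  proof (rule eq_matI)
    fix i j assume ij: "i < dim_row (c \<cdot>\<^sub>m 1\<^sub>m n)" "j < dim_col (c \<cdot>\<^sub>m 1\<^sub>m n)"
    have "unit_vec n j \<in> W" using W by simp
    then have "(A *\<^sub>v unit_vec n j) $ i = (c \<cdot>\<^sub>v unit_vec n j) $ i" by (simp add: W_def)
    then show "A $$ (i, j) = (c \<cdot>\<^sub>m 1\<^sub>m n) $$ (i, j)" using ij A by auto
  qed (use A in auto)
  then show thesis using that by blast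
qed

text \<open>If all commutators with \<open>g\<close> lie in the kernel, then \<open>\<rho> g\<close>
  commutes with the whole image and is scalar by Schur's lemma. The later arguments use this to pass
  between scalars and commutators.\<close>

lemma rep_center_iff:
  assumes irr: "irr_rep G n \<rho>"
  shows "g \<in> rep_center G n \<rho> \<longleftrightarrow>
    g \<in> carrier G \<and> (\<forall>h \<in> carrier G. commutator G g h \<in> rep_ker G n \<rho>)"
proof
  assume "g \<in> rep_center G n \<rho>"
  then show "g \<in> carrier G \<and> (\<forall>h \<in> carrier G. commutator G g h \<in> rep_ker G n \<rho>)"
    using rep_center_commutator[OF irr_rep_is_rep[OF irr]] by (auto simp: rep_center_def)
next
  assume *: "g \<in> carrier G \<and> (\<forall>h \<in> carrier G. commutator G g h \<in> rep_ker G n \<rho>)"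
  note rep = irr_rep_is_rep[OF irr]
  obtain c where "\<rho> g = c \<cdot>\<^sub>m 1\<^sub>m n"
    using schur_scalar[OF irr, of "\<rho> g"] rep_carrier[OF rep] commutator_in_ker_iff[OF rep] * by metis
  then show "g \<in> rep_center G n \<rho>" using * by (auto simp: rep_center_def)
qed

end

section \<open>Orthogonality and the relation between degree and center\<close>

context fin_group
begin

lemma order_pos: "card (carrier G) > 0"
  using fin by (auto simp: card_gt_0_iff)

lemma rep_pow_order:
  assumes rep: "is_rep G n \<rho>" and g: "g \<in> carrier G"
  shows "\<rho> g ^\<^sub>m card (carrier G) = 1\<^sub>m n"
  using pow_order_eq_1[OF g, unfolded Coset.order_def] rep_pow[OF rep g, of "card (carrier G)"] rep_one[OF rep] by simp

lemma rep_trace_inv: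
  assumes rep: "is_rep G n \<rho>" and g: "g \<in> carrier G"
  shows "mat_trace (\<rho> (inv g)) = cnj (mat_trace (\<rho> g))"
proof -
  have "g [^] (card (carrier G) - 1) \<otimes> g = \<one>"
    using pow_order_eq_1[OF g, unfolded Coset.order_def] order_pos nat_pow_Suc[of g "card (carrier G) - 1"] by simp
  then have "inv g = g [^] (card (carrier G) - 1)" using g by (intro inv_equality) auto
  then have "\<rho> (inv g) = \<rho> g ^\<^sub>m (card (carrier G) - 1)" using rep_pow[OF rep g] by simp
  then show ?thesis
    using trace_pow_pred[OF rep_carrier[OF rep g] order_pos rep_pow_order[OF rep g]] by simp
qed

lemma rep_trace_eq_dim:
  assumes rep: "is_rep G n \<rho>" and g: "g \<in> carrier G" and tr: "mat_trace (\<rho> g) = of_nat n"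
  shows "\<rho> g = 1\<^sub>m n"
  using finite_order_trace_eq_dim[OF rep_carrier[OF rep g] order_pos rep_pow_order[OF rep g] tr] .

text \<open>The sum \<open>S\<close> of the conjugates of the matrix unit with its 1 at
  \<open>(i, j)\<close> commutes with the image, so it is a scalar matrix; its trace is
  \<open>|G|\<close> if \<open>i = j\<close> and 0 otherwise, and its \<open>(i, j)\<close> entry is
  the sum in question. Diagonal coefficients suffice to compute with traces.\<close>

lemma schur_orthogonality:
  assumes irr: "irr_rep G n \<rho>" and ij: "i < n" "j < n"
  shows "of_nat n * (\<Sum>g\<in>carrier G. \<rho> g $$ (i, i) * \<rho> (inv g) $$ (j, j))
    = (if i = j then of_nat (card (carrier G)) else 0)"
proof -
  note rep = irr_rep_is_rep[OF irr]
  have C: "\<rho> g \<in> carrier_mat n n" if "g \<in> carrier G" for g using rep_carrier[OF rep that] .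
  have mult: "\<rho> (g \<otimes> h) $$ (r, s) = (\<Sum>t<n. \<rho> g $$ (r, t) * \<rho> h $$ (t, s))"
    if "g \<in> carrier G" "h \<in> carrier G" "r < n" "s < n" for g h r s
    using that C[of g] C[of h] by (simp add: rep_mult[OF rep] scalar_prod_def atLeast0LessThan)
  define S where "S = mat n n (\<lambda>(r, s). \<Sum>g\<in>carrier G. \<rho> g $$ (r, i) * \<rho> (inv g) $$ (j, s))"
  have S: "S \<in> carrier_mat n n" by (simp add: S_def)
  have "S * \<rho> h = \<rho> h * S" if h: "h \<in> carrier G" for h
  proof (rule eq_matI)
    fix r s assume rs0: "r < dim_row (\<rho> h * S)" "s < dim_col (\<rho> h * S)"
    then have rs: "r < n" "s < n" using C[OF h] S by auto
    have "(\<rho> h * S) $$ (r, s) = (\<Sum>t<n. \<Sum>g\<in>carrier G. \<rho> h $$ (r, t) * (\<rho> g $$ (t, i) * \<rho> (inv g) $$ (j, s)))"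
      using rs C[OF h] S by (simp add: scalar_prod_def atLeast0LessThan S_def sum_distrib_left)
    also have "\<dots> = (\<Sum>g\<in>carrier G. \<rho> (h \<otimes> g) $$ (r, i) * \<rho> (inv g) $$ (j, s))"
      using h rs ij by (subst sum.swap) (simp add: mult sum_distrib_right mult.assoc)
    also have "\<dots> = (\<Sum>g\<in>carrier G. \<rho> g $$ (r, i) * \<rho> (inv g \<otimes> h) $$ (j, s))"
      using h by (intro sum.reindex_bij_witness[of _ "\<lambda>g. inv h \<otimes> g" "\<lambda>g. h \<otimes> g"])
        (auto simp: m_assoc[symmetric] inv_mult_group, simp add: m_assoc)
    also have "\<dots> = (\<Sum>t<n. \<Sum>g\<in>carrier G. \<rho> g $$ (r, i) * \<rho> (inv g) $$ (j, t) * \<rho> h $$ (t, s))"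
      using h rs ij by (subst sum.swap) (simp add: mult sum_distrib_left mult.assoc)
    also have "\<dots> = (S * \<rho> h) $$ (r, s)"
      using rs C[OF h] S by (simp add: scalar_prod_def atLeast0LessThan S_def sum_distrib_right)
    finally show "(S * \<rho> h) $$ (r, s) = (\<rho> h * S) $$ (r, s)" by simp
  qed (use C[OF h] S in auto)
  then obtain c where c: "S = c \<cdot>\<^sub>m 1\<^sub>m n" using schur_scalar[OF irr S] by metis
  have "c * of_nat n = mat_trace S" by (simp add: c mat_trace_smult_one)
  also have "\<dots> = (\<Sum>g\<in>carrier G. \<Sum>r<n. \<rho> (inv g) $$ (j, r) * \<rho> g $$ (r, i))"
    by (subst sum.swap) (simp add: mat_trace_def S_def mult.commute)
  also have "\<dots> = (\<Sum>g\<in>carrier G. \<rho> (inv g \<otimes> g) $$ (j, i))"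
    using ij by (intro sum.cong refl) (simp only: mult inv_closed)
  also have "\<dots> = (if i = j then of_nat (card (carrier G)) else 0)"
    using ij by (simp add: rep_one[OF rep])
  finally have "c * of_nat n = (if i = j then of_nat (card (carrier G)) else 0)" .
  moreover have "(\<Sum>g\<in>carrier G. \<rho> g $$ (i, i) * \<rho> (inv g) $$ (j, j)) = S $$ (i, j)"
    using ij by (simp add: S_def)
  moreover have "S $$ (i, j) = (if i = j then c else 0)" using ij by (simp add: c)
  ultimately show ?thesis by (auto simp: mult.commute split: if_splits)
qed

text \<open>The relation \<open>[\<chi>, \<chi>] = 1\<close>, obtained by expanding both traces and
  summing the orthogonality relations over all pairs of diagonal positions.\<close>

lemma sum_norm_trace:
  assumes irr: "irr_rep G n \<rho>"
  shows "(\<Sum>g\<in>carrier G. (norm (mat_trace (\<rho> g)))\<^sup>2) = real (card (carrier G))"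
proof -
  note rep = irr_rep_is_rep[OF irr] and n = irr_rep_pos[OF irr]
  have dim: "dim_row (\<rho> g) = n" if "g \<in> carrier G" for g using rep_carrier[OF rep that] by auto
  have "of_nat n * (\<Sum>g\<in>carrier G. mat_trace (\<rho> g) * mat_trace (\<rho> (inv g)))
    = of_nat n * (\<Sum>g\<in>carrier G. \<Sum>i<n. \<Sum>j<n. \<rho> g $$ (i, i) * \<rho> (inv g) $$ (j, j))"
    by (simp add: mat_trace_def dim sum_product)
  also have "(\<Sum>g\<in>carrier G. \<Sum>i<n. \<Sum>j<n. \<rho> g $$ (i, i) * \<rho> (inv g) $$ (j, j))
    = (\<Sum>i<n. \<Sum>j<n. \<Sum>g\<in>carrier G. \<rho> g $$ (i, i) * \<rho> (inv g) $$ (j, j))"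
    by (subst sum.swap) (intro sum.cong refl sum.swap)
  also have "of_nat n * \<dots> = (\<Sum>i<n. \<Sum>j<n. if i = j then of_nat (card (carrier G)) else 0)"
    unfolding sum_distrib_left[of "of_nat n" _ "{..<n}"]
    by (intro sum.cong refl schur_orthogonality[OF irr]) auto
  also have "\<dots> = of_nat n * of_nat (card (carrier G))" by simp
  finally have "(\<Sum>g\<in>carrier G. mat_trace (\<rho> g) * mat_trace (\<rho> (inv g))) = of_nat (card (carrier G))"
    using n by simp
  moreover have "mat_trace (\<rho> g) * mat_trace (\<rho> (inv g)) = of_real ((norm (mat_trace (\<rho> g)))\<^sup>2)"
    if "g \<in> carrier G" for g
    using rep_trace_inv[OF rep that] complex_norm_square[of "mat_trace (\<rho> g)"] by simp
  ultimately have "of_real (\<Sum>g\<in>carrier G. (norm (mat_trace (\<rho> g)))\<^sup>2) = (of_real (real (card (carrier G))) :: complex)"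
    by simp
  then show ?thesis using of_real_eq_iff by blast
qed

lemma norm_trace_rep_center:
  assumes rep: "is_rep G n \<rho>" and n: "n > 0" and g: "g \<in> rep_center G n \<rho>"
  shows "norm (mat_trace (\<rho> g)) = real n"
proof -
  obtain c where c: "\<rho> g = c \<cdot>\<^sub>m 1\<^sub>m n" and gc: "g \<in> carrier G" using g by (auto simp: rep_center_def)
  have "upper_triangular (c \<cdot>\<^sub>m 1\<^sub>m n)" by auto
  then have "((c \<cdot>\<^sub>m 1\<^sub>m n) ^\<^sub>m card (carrier G)) $$ (0, 0) = c ^ card (carrier G)"
    using upper_triangular_diag_pow[of "c \<cdot>\<^sub>m 1\<^sub>m n" n "card (carrier G)"] n by auto
  then have "c ^ card (carrier G) = 1" using rep_pow_order[OF rep gc] c n by simp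
  then show ?thesis using root_of_unity_norm[OF _ order_pos] by (simp add: c mat_trace_smult_one norm_mult)
qed

lemma sum_norm_trace_center:
  assumes rep: "is_rep G n \<rho>" and n: "n > 0"
  shows "(\<Sum>g\<in>rep_center G n \<rho>. (norm (mat_trace (\<rho> g)))\<^sup>2) = real (n\<^sup>2 * card (rep_center G n \<rho>))"
  using norm_trace_rep_center[OF rep n] by simp

text \<open>The character has absolute value \<open>n\<close> on its center, so the center alone
  contributes the left-hand side to a sum of nonnegative terms whose total is
  \<open>|G|\<close>.\<close>

lemma degree_square_center_le:
  assumes irr: "irr_rep G n \<rho>"
  shows "n\<^sup>2 * card (rep_center G n \<rho>) \<le> card (carrier G)"
proof -
  have "real (n\<^sup>2 * card (rep_center G n \<rho>)) \<le> (\<Sum>g\<in>carrier G. (norm (mat_trace (\<rho> g)))\<^sup>2)"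
    unfolding sum_norm_trace_center[OF irr_rep_is_rep[OF irr] irr_rep_pos[OF irr], symmetric]
    by (rule sum_mono2[OF fin]) (auto simp: rep_center_def)
  then show ?thesis unfolding sum_norm_trace[OF irr] by linarith
qed

text \<open>The equality case of the preceding estimate, meant for characters of class 2, which
  vanish off their center by the next lemma.\<close>

lemma degree_square_center_eq:
  assumes irr: "irr_rep G n \<rho>"
    and vanish: "\<And>g. g \<in> carrier G - rep_center G n \<rho> \<Longrightarrow> mat_trace (\<rho> g) = 0"
  shows "n\<^sup>2 * card (rep_center G n \<rho>) = card (carrier G)"
proof -
  have "real (n\<^sup>2 * card (rep_center G n \<rho>)) = (\<Sum>g\<in>carrier G. (norm (mat_trace (\<rho> g)))\<^sup>2)"
    unfolding sum_norm_trace_center[OF irr_rep_is_rep[OF irr] irr_rep_pos[OF irr], symmetric]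
    by (rule sum.mono_neutral_left[OF fin]) (auto simp: rep_center_def vanish)
  then show ?thesis unfolding sum_norm_trace[OF irr] by linarith
qed

text \<open>If \<open>\<rho>\<close> maps \<open>[g, h]\<close> to a scalar \<open>c \<noteq> 1\<close>, then \<open>\<rho> g\<close> is similar to \<open>c \<rho> g\<close>.\<close>
lemma trace_eq_0_if_commutators_central:
  assumes irr: "irr_rep G n \<rho>" and g: "g \<in> carrier G - rep_center G n \<rho>"
    and cen: "\<And>h. h \<in> carrier G \<Longrightarrow> commutator G g h \<in> rep_center G n \<rho>"
  shows "mat_trace (\<rho> g) = 0"
proof -
  note rep = irr_rep_is_rep[OF irr] and n = irr_rep_pos[OF irr]
  obtain h where h: "h \<in> carrier G" and nk: "commutator G g h \<notin> rep_ker G n \<rho>"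
    using g rep_center_iff[OF irr, of g] by blast
  have gc: "g \<in> carrier G" using g by simp
  obtain c where c: "\<rho> (commutator G g h) = c \<cdot>\<^sub>m 1\<^sub>m n" using cen[OF h] by (auto simp: rep_center_def)
  have c1: "c \<noteq> 1" using nk c gc h by (auto simp: rep_ker_def)
  have C: "\<rho> g \<in> carrier_mat n n" "\<rho> h \<in> carrier_mat n n" "\<rho> (inv h) \<in> carrier_mat n n"
    using rep_carrier[OF rep] gc h by auto
  have "\<rho> g = \<rho> g * \<rho> h * \<rho> (inv h)"
    using C rep_inv[OF rep h] by (simp add: assoc_mult_mat[of _ n n _ n _ n])
  also have "\<rho> g * \<rho> h = c \<cdot>\<^sub>m (\<rho> h * \<rho> g)"
    using rep_commutator[OF rep gc h] C by (simp add: c smult_one_mat_mult[of _ n])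
  finally have "mat_trace (\<rho> g) = mat_trace (c \<cdot>\<^sub>m (\<rho> h * \<rho> g) * \<rho> (inv h))" by simp
  also have "\<dots> = c * mat_trace ((\<rho> h * \<rho> g) * \<rho> (inv h))"
    using C by (subst mult_smult_assoc_mat[of _ n n _ n]) (auto simp: mat_trace_def sum_distrib_left)
  also have "mat_trace ((\<rho> h * \<rho> g) * \<rho> (inv h)) = mat_trace (\<rho> (inv h) * (\<rho> h * \<rho> g))"
    using C by (intro mat_trace_mult_comm) auto
  also have "\<rho> (inv h) * (\<rho> h * \<rho> g) = \<rho> g"
    using C rep_inv[OF rep h] by (simp add: assoc_mult_mat[of _ n n _ n _ n, symmetric])
  finally show ?thesis using c1 by simp
qed

end

section \<open>Separation by irreducible representations\<close>

context fin_group
begin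

text \<open>Permutation matrices of left multiplication, with respect to an enumeration
  \<open>e\<close> of the group. An element acting as the identity matrix fixes the basis vector of
  \<open>\<one>\<close>, so it is \<open>\<one>\<close>.\<close>

lemma regular_rep:
  obtains m R where "is_rep G m R" "\<And>q. q \<in> carrier G \<Longrightarrow> R q = 1\<^sub>m m \<Longrightarrow> q = \<one>"
proof -
  define m where "m = card (carrier G)"
  obtain e where e: "bij_betw e {..<m} (carrier G)"
    using ex_bij_betw_nat_finite[OF fin] by (auto simp: m_def atLeast0LessThan)
  have ec: "e i \<in> carrier G" if "i < m" for i using e that by (auto simp: bij_betw_def)
  have surj: "\<exists>i<m. e i = q" if "q \<in> carrier G" for q
    using e that unfolding bij_betw_def by (metis imageE lessThan_iff)
  have inj: "e i = e j \<longleftrightarrow> i = j" if "i < m" "j < m" for i j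
    using e that by (auto simp: bij_betw_def inj_on_def)
  define R where "R q = mat m m (\<lambda>(i, j). if e i = q \<otimes> e j then 1 else 0 :: complex)" for q
  have "is_rep G m R"
    unfolding is_rep_def
  proof (intro conjI ballI)
    show "R g \<in> carrier_mat m m" for g by (simp add: R_def)
    show "R \<one> = 1\<^sub>m m" by (intro eq_matI) (auto simp: R_def ec inj)
    fix g h assume g: "g \<in> carrier G" and h: "h \<in> carrier G"
    show "R (g \<otimes> h) = R g * R h"
    proof (rule eq_matI)
      fix i j assume "i < dim_row (R g * R h)" "j < dim_col (R g * R h)"
      then have ij: "i < m" "j < m" by (auto simp: R_def)
      obtain l0 where l0: "l0 < m" "e l0 = h \<otimes> e j" using surj[of "h \<otimes> e j"] h ec[OF ij(2)] by auto
      have "(R g * R h) $$ (i, j)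
          = (\<Sum>l<m. (if e i = g \<otimes> e l then 1 else 0) * (if e l = h \<otimes> e j then 1 else 0))"
        using ij by (simp add: R_def scalar_prod_def atLeast0LessThan)
      also have "\<dots> = (\<Sum>l<m. if l = l0 then (if e i = g \<otimes> e l0 then 1 else 0) else 0)"
        using l0 inj by (intro sum.cong) (auto simp flip: l0(2))
      also have "\<dots> = (if e i = g \<otimes> h \<otimes> e j then 1 else 0)"
        using l0 g h ec[OF ij(2)] by (simp add: m_assoc)
      finally show "R (g \<otimes> h) $$ (i, j) = (R g * R h) $$ (i, j)" using ij by (simp add: R_def)
    qed (auto simp: R_def)
  qed
  moreover have "q = \<one>" if q: "q \<in> carrier G" and R: "R q = 1\<^sub>m m" for q
  proof -
    obtain j where j: "j < m" "e j = \<one>" using surj[of \<one>] by auto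
    then have "R q $$ (j, j) = 1" using R by simp
    then show ?thesis using j q by (auto simp: R_def split: if_splits)
  qed
  ultimately show thesis using that by blast
qed

text \<open>Inflation of the regular representation of \<open>G Mod N\<close>. It provides a
  starting point for choosing a representation of least degree.\<close>

lemma rep_of_quotient:
  assumes N: "N \<lhd> G"
  obtains m \<rho> where "is_rep G m \<rho>" "rep_ker G m \<rho> = N"
proof -
  interpret N: normal N G using N .
  interpret Q: fin_group "G Mod N"
    using N.factorgroup_is_group fin
    by (intro fin_group.intro fin_group_axioms.intro) (auto simp: FactGroup_def RCOSETS_def)
  obtain m R where R: "is_rep (G Mod N) m R"
    and faithful: "\<And>q. q \<in> carrier (G Mod N) \<Longrightarrow> R q = 1\<^sub>m m \<Longrightarrow> q = \<one>\<^bsub>G Mod N\<^esub>"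
    using Q.regular_rep by blast
  have hom: "N #> (g \<otimes> h) = (N #> g) \<otimes>\<^bsub>G Mod N\<^esub> (N #> h)" "N #> g \<in> carrier (G Mod N)"
    if "g \<in> carrier G" "h \<in> carrier G" for g h
    using N.r_coset_hom_Mod that by (auto simp: hom_def)
  have one: "N #> \<one> = \<one>\<^bsub>G Mod N\<^esub>" by (simp add: FactGroup_def coset_mult_one N.subset)
  have "is_rep G m (\<lambda>g. R (N #> g))"
    using R hom one by (auto simp: is_rep_def)
  moreover have "rep_ker G m (\<lambda>g. R (N #> g)) = N"
  proof -
    have "R (N #> g) = 1\<^sub>m m \<longleftrightarrow> N #> g = N" if "g \<in> carrier G" for g
      using faithful[of "N #> g"] hom[OF that that] R by (auto simp: FactGroup_def is_rep_def)
    moreover have "N #> g = N \<longleftrightarrow> g \<in> N" if "g \<in> carrier G" for g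
      using that coset_join1[of N g] coset_join2[OF that N.subgroup_axioms] N.subgroup_axioms by auto
    ultimately show ?thesis using N.subset by (auto simp: rep_ker_def)
  qed
  ultimately show thesis using that by blast
qed

text \<open>A representation of least degree in which \<open>g\<close> acts nontrivially is irreducible: with
  respect to an invariant subspace it is block triangular, by minimality \<open>g\<close> acts trivially on
  both diagonal blocks, so its trace is the degree.\<close>
lemma separating_irr_rep:
  assumes N: "N \<lhd> G" and g: "g \<in> carrier G" "g \<notin> N"
  obtains n \<rho> where "irr_rep G n \<rho>" "N \<subseteq> rep_ker G n \<rho>" "g \<notin> rep_ker G n \<rho>"
proof -
  define ok where "ok n \<rho> \<longleftrightarrow> is_rep G n \<rho> \<and> N \<subseteq> rep_ker G n \<rho> \<and> g \<notin> rep_ker G n \<rho>" for n \<rho>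
  have "\<exists>n \<rho>. ok n \<rho>" using rep_of_quotient[OF N] g unfolding ok_def by (metis subset_refl)
  then obtain n where "\<exists>\<rho>. ok n \<rho>" and min: "\<And>k \<sigma>. k < n \<Longrightarrow> \<not> ok k \<sigma>"
    using exists_least_iff[of "\<lambda>n. \<exists>\<rho>. ok n \<rho>"] by blast
  then obtain \<rho> where ok: "ok n \<rho>" by blast
  then have rep: "is_rep G n \<rho>" and Nk: "N \<subseteq> rep_ker G n \<rho>" and gk: "\<rho> g \<noteq> 1\<^sub>m n"
    using g by (auto simp: ok_def rep_ker_def)
  have C: "\<rho> x \<in> carrier_mat n n" if "x \<in> carrier G" for x using rep_carrier[OF rep that] .
  have NG: "N \<subseteq> carrier G" using N by (simp add: normal_imp_subgroup subgroup.subset)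
  have "W = {0\<^sub>v n} \<or> W = carrier_vec n"
    if W: "is_subspace n W" and inv: "\<And>x w. x \<in> carrier G \<Longrightarrow> w \<in> W \<Longrightarrow> \<rho> x *\<^sub>v w \<in> W" for W
  proof (rule ccontr)
    assume neg: "\<not> (W = {0\<^sub>v n} \<or> W = carrier_vec n)"
    obtain P Q k where P: "P \<in> carrier_mat n n" and Q: "Q \<in> carrier_mat n n"
      and PQ: "P * Q = 1\<^sub>m n" and QP: "Q * P = 1\<^sub>m n" and kn: "k \<le> n"
      and cW: "\<And>j. j < k \<Longrightarrow> col P j \<in> W"
      and zW: "\<And>w i. w \<in> W \<Longrightarrow> k \<le> i \<Longrightarrow> i < n \<Longrightarrow> (Q *\<^sub>v w) $ i = 0"
      using subspace_adapted_basis[OF W] by metis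
    have PQv: "P *\<^sub>v (Q *\<^sub>v w) = w" if "w \<in> carrier_vec n" for w
      using that P Q PQ by (simp add: assoc_mult_mat_vec[of _ n n _ n, symmetric])
    have Wc: "W \<subseteq> carrier_vec n" and W0: "0\<^sub>v n \<in> W" using W by (auto simp: is_subspace_def)
    have "k \<noteq> 0"
    proof
      assume "k = 0"
      have "w = 0\<^sub>v n" if w: "w \<in> W" for w
      proof -
        have "Q *\<^sub>v w = 0\<^sub>v n" using zW[OF w] \<open>k = 0\<close> Q by (intro eq_vecI) auto
        moreover have "w \<in> carrier_vec n" using w Wc by auto
        ultimately show ?thesis using PQv[of w] P by auto
      qed
      then have "W = {0\<^sub>v n}" using W0 by blast
      then show False using neg by simp
    qed
    have "k \<noteq> n"
    proof
      assume "k = n"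
      have "w \<in> W" if w: "w \<in> carrier_vec n" for w
      proof -
        have "P *\<^sub>v (Q *\<^sub>v w) = vec n (\<lambda>i. \<Sum>j<n. (Q *\<^sub>v w) $ j * col P j $ i)"
          using P Q by (intro eq_vecI) (auto simp: scalar_prod_def atLeast0LessThan mult.commute)
        also have "\<dots> \<in> W" using is_subspace_sum[OF W] cW \<open>k = n\<close> by blast
        finally show ?thesis using PQv[OF w] by simp
      qed
      then have "W = carrier_vec n" using Wc by blast
      then show False using neg by simp
    qed
    have k: "0 < k" "k < n" using kn \<open>k \<noteq> 0\<close> \<open>k \<noteq> n\<close> by auto
    define \<sigma> where "\<sigma> x = Q * \<rho> x * P" for x
    have S: "\<sigma> x \<in> carrier_mat n n" if "x \<in> carrier G" for x
      using C[OF that] P Q by (simp add: \<sigma>_def)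
    have cl: "X * Y \<in> carrier_mat n n" if "X \<in> carrier_mat n n" "Y \<in> carrier_mat n n" for X Y :: "complex mat"
      using that by simp
    have PQX: "P * (Q * X) = X" if "X \<in> carrier_mat n n" for X
      using assoc_mult_mat[OF P Q that] PQ that by simp
    have \<sigma>_mult: "\<sigma> (x \<otimes> y) = \<sigma> x * \<sigma> y" if xy: "x \<in> carrier G" "y \<in> carrier G" for x y
      by (simp add: \<sigma>_def rep_mult[OF rep xy] assoc_mult_mat[of _ n n _ n _ n] cl PQX C[OF xy(1)] C[OF xy(2)] P Q)
    have \<sigma>_one: "\<sigma> x = 1\<^sub>m n" if "\<rho> x = 1\<^sub>m n" for x using that P Q QP by (simp add: \<sigma>_def)
    have entry: "\<sigma> (x \<otimes> y) $$ (i, j) = (\<Sum>l<n. \<sigma> x $$ (i, l) * \<sigma> y $$ (l, j))"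
      if "x \<in> carrier G" "y \<in> carrier G" "i < n" "j < n" for x y i j
      using that S[of x] S[of y] by (simp add: \<sigma>_mult scalar_prod_def atLeast0LessThan)
    \<comment> \<open>Invariance of \<open>W\<close> enters here: the first \<open>k\<close> columns
      of \<open>P\<close> lie in \<open>W\<close>, so do their images under \<open>\<rho> x\<close>,
      and vectors of \<open>W\<close> have no coordinates from \<open>k\<close> on.\<close>
    have zero: "\<sigma> x $$ (i, j) = 0" if x: "x \<in> carrier G" and ij: "k \<le> i" "i < n" "j < k" for x i j
    proof -
      have "\<sigma> x = Q * (\<rho> x * P)" unfolding \<sigma>_def by (rule assoc_mult_mat[OF Q C[OF x] P])
      then have "col (\<sigma> x) j = Q *\<^sub>v (\<rho> x *\<^sub>v col P j)"
        using col_mult2[OF Q cl[OF C[OF x] P], of j] col_mult2[OF C[OF x] P, of j] ij k by simp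
      moreover have "\<sigma> x $$ (i, j) = col (\<sigma> x) j $ i" using S[OF x] ij k by simp
      moreover have "(Q *\<^sub>v (\<rho> x *\<^sub>v col P j)) $ i = 0"
        by (rule zW[OF inv[OF x cW[OF ij(3)]] ij(1,2)])
      ultimately show ?thesis by simp
    qed
    \<comment> \<open>\<open>A\<close> is the action on \<open>W\<close> and \<open>D\<close> the
      action on the quotient space by \<open>W\<close>. Both degrees, \<open>k\<close> and
      \<open>n - k\<close>, are less than \<open>n\<close>, so minimality applies to either
      block.\<close>
    define A where "A x = mat k k (\<lambda>(i, j). \<sigma> x $$ (i, j))" for x
    define D where "D x = mat (n - k) (n - k) (\<lambda>(i, j). \<sigma> x $$ (k + i, k + j))" for x
    have splt: "(\<Sum>l<n. f l) = (\<Sum>l<k. f l) + (\<Sum>l<n - k. f (k + l))" for f :: "nat \<Rightarrow> complex"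
      using sum.atLeastLessThan_concat[of 0 k n f] sum.shift_bounds_nat_ivl[of f 0 k "n - k"] k
      by (simp add: atLeast0LessThan add.commute)
    have "is_rep G k A"
      unfolding is_rep_def
    proof (intro conjI ballI)
      fix x y assume xy: "x \<in> carrier G" "y \<in> carrier G"
      show "A (x \<otimes> y) = A x * A y"
      proof (rule eq_matI)
        fix i j assume "i < dim_row (A x * A y)" "j < dim_col (A x * A y)"
        then have ij: "i < k" "j < k" by (auto simp: A_def)
        have "(\<Sum>l<n - k. \<sigma> x $$ (i, k + l) * \<sigma> y $$ (k + l, j)) = 0"
          using zero[OF xy(2) _ _ ij(2)] by (intro sum.neutral ballI) simp
        then have "\<sigma> (x \<otimes> y) $$ (i, j) = (\<Sum>l<k. \<sigma> x $$ (i, l) * \<sigma> y $$ (l, j))"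
          using entry[OF xy, of i j] ij k by (simp only: splt) simp
        then show "A (x \<otimes> y) $$ (i, j) = (A x * A y) $$ (i, j)"
          using ij by (simp add: A_def scalar_prod_def atLeast0LessThan)
      qed (simp_all add: A_def)
    qed (use k in \<open>auto simp: A_def \<sigma>_one rep_one[OF rep]\<close>)
    moreover have "is_rep G (n - k) D"
      unfolding is_rep_def
    proof (intro conjI ballI)
      fix x y assume xy: "x \<in> carrier G" "y \<in> carrier G"
      show "D (x \<otimes> y) = D x * D y"
      proof (rule eq_matI)
        fix i j assume "i < dim_row (D x * D y)" "j < dim_col (D x * D y)"
        then have ij: "i < n - k" "j < n - k" by (auto simp: D_def)
        have "(\<Sum>l<k. \<sigma> x $$ (k + i, l) * \<sigma> y $$ (l, k + j)) = 0"
          using zero[OF xy(1), of "k + i"] ij by (intro sum.neutral ballI) simp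
        then have "\<sigma> (x \<otimes> y) $$ (k + i, k + j)
            = (\<Sum>l<n - k. \<sigma> x $$ (k + i, k + l) * \<sigma> y $$ (k + l, k + j))"
          using entry[OF xy, of "k + i" "k + j"] ij k by (simp only: splt) simp
        then show "D (x \<otimes> y) $$ (i, j) = (D x * D y) $$ (i, j)"
          using ij by (simp add: D_def scalar_prod_def atLeast0LessThan)
      qed (simp_all add: D_def)
    qed (use k in \<open>auto simp: D_def \<sigma>_one rep_one[OF rep]\<close>)
    moreover have "N \<subseteq> rep_ker G k A" "N \<subseteq> rep_ker G (n - k) D"
    proof -
      have "x \<in> carrier G" "\<sigma> x = 1\<^sub>m n" if "x \<in> N" for x
        using Nk that \<sigma>_one by (auto simp: rep_ker_def)
      then show "N \<subseteq> rep_ker G k A" "N \<subseteq> rep_ker G (n - k) D"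
        using k by (auto simp: rep_ker_def A_def D_def intro!: eq_matI)
    qed
    ultimately have "g \<in> rep_ker G k A" "g \<in> rep_ker G (n - k) D"
      using min[of k A] min[of "n - k" D] k unfolding ok_def by (blast, simp)
    then have A1: "A g = 1\<^sub>m k" and D1: "D g = 1\<^sub>m (n - k)" by (simp_all add: rep_ker_def)
    have "\<sigma> g $$ (i, i) = 1" if "i < n" for i
    proof (cases "i < k")
      case True
      then have "\<sigma> g $$ (i, i) = A g $$ (i, i)" by (simp add: A_def)
      then show ?thesis using A1 True by simp
    next
      case False
      then have "\<sigma> g $$ (i, i) = D g $$ (i - k, i - k)" using that by (simp add: D_def)
      then show ?thesis using D1 False that by simp
    qed
    then have "mat_trace (\<sigma> g) = of_nat n" using S[OF g(1)] by (simp add: mat_trace_def)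
    moreover have "mat_trace (\<sigma> g) = mat_trace (P * (Q * \<rho> g))"
      unfolding \<sigma>_def using C[OF g(1)] P Q by (intro mat_trace_mult_comm) auto
    moreover have "P * (Q * \<rho> g) = \<rho> g"
      using C[OF g(1)] P Q PQ by (simp add: assoc_mult_mat[of _ n n _ n _ n, symmetric])
    ultimately have "\<rho> g = 1\<^sub>m n" using rep_trace_eq_dim[OF rep g(1)] by simp
    then show False using gk by simp
  qed
  \<comment> \<open>All matrices of size 0 are equal, so in degree 0 the element \<open>g\<close>
    would act trivially.\<close>
  moreover have "n \<ge> 1"
  proof (rule ccontr)
    assume "\<not> n \<ge> 1"
    then have "\<rho> g = 1\<^sub>m n" using C[OF g(1)] by (intro eq_matI) auto
    then show False using gk by simp
  qed
  ultimately have "irr_rep G n \<rho>" using rep by (auto simp: irr_rep_def)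
  then show thesis using that ok by (auto simp: ok_def)
qed

text \<open>The kernel of the character is that of the representation, since a trace equal to the
  degree forces the identity matrix. From here on codegrees are expressed through
  \<open>rep_ker\<close> and the degree.\<close>

lemma codegree_character:
  assumes irr: "irr_rep G n \<rho>"
  shows "codegree G (character G \<rho>) = real (card (carrier G)) / real (card (rep_ker G n \<rho>)) / real n"
proof -
  note rep = irr_rep_is_rep[OF irr]
  have one: "character G \<rho> \<one> = of_nat n"
    by (simp add: character_def rep_one[OF rep] mat_trace_one)
  have "character G \<rho> g = of_nat n \<longleftrightarrow> \<rho> g = 1\<^sub>m n" if "g \<in> carrier G" for g
  proof
    assume "character G \<rho> g = of_nat n"
    then show "\<rho> g = 1\<^sub>m n" using rep_trace_eq_dim[OF rep that] that by (simp add: character_def)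
  next
    assume "\<rho> g = 1\<^sub>m n"
    then show "character G \<rho> g = of_nat n" using that by (simp add: character_def mat_trace_one)
  qed
  then have "char_ker G (character G \<rho>) = rep_ker G n \<rho>"
    unfolding char_ker_def rep_ker_def one by blast
  then show ?thesis by (simp add: codegree_def one)
qed

text \<open>Elements of \<open>S\<close> are determined modulo the kernel by the scalar by which they act, a
  \<open>k\<close>-th root of unity.\<close>
lemma card_central_le:
  assumes rep: "is_rep G n \<rho>" and n: "n > 0" and S: "S \<subseteq> rep_center G n \<rho>" and k: "k > 0"
    and pow: "\<And>z. z \<in> S \<Longrightarrow> z [^] (k::nat) \<in> rep_ker G n \<rho>"
  shows "card S \<le> k * card (rep_ker G n \<rho>)"
proof -
  define f where "f z = \<rho> z $$ (0, 0)" for z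
  have SG: "S \<subseteq> carrier G" using S by (auto simp: rep_center_def)
  have finS: "finite S" using SG fin finite_subset by blast
  have scal: "\<rho> z = f z \<cdot>\<^sub>m 1\<^sub>m n" if z: "z \<in> S" for z
    using S z n by (auto simp: rep_center_def f_def)
  have root: "f z ^ k = 1" if z: "z \<in> S" for z
  proof -
    have zG: "z \<in> carrier G" using z SG by auto
    have "upper_triangular (f z \<cdot>\<^sub>m 1\<^sub>m n)" by auto
    then have "(\<rho> z ^\<^sub>m k) $$ (0, 0) = f z ^ k"
      using upper_triangular_diag_pow[of "f z \<cdot>\<^sub>m 1\<^sub>m n" n k] n scal[OF z] by auto
    then show ?thesis using rep_pow[OF rep zG, of k] pow[OF z] n by (simp add: rep_ker_def)
  qed
  have finK: "finite (rep_ker G n \<rho>)" using fin by (simp add: rep_ker_def)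
  have fib: "card {z \<in> S. f z = w} \<le> card (rep_ker G n \<rho>)" if w: "w \<in> f ` S" for w
  proof -
    obtain x where x: "x \<in> S" "f x = w" using w by auto
    have "{z \<in> S. f z = w} \<subseteq> (\<lambda>d. x \<otimes> d) ` rep_ker G n \<rho>"
    proof
      fix y assume "y \<in> {z \<in> S. f z = w}"
      then have y: "y \<in> S" "\<rho> y = \<rho> x" using x scal by auto
      have xG: "x \<in> carrier G" "y \<in> carrier G" using x y SG by auto
      have "\<rho> (inv x \<otimes> y) = 1\<^sub>m n"
        using rep_mult[OF rep, of "inv x" y] xG y rep_inv[OF rep, of x] by simp
      then have "inv x \<otimes> y \<in> rep_ker G n \<rho>" using xG by (simp add: rep_ker_def)
      moreover have "y = x \<otimes> (inv x \<otimes> y)" using xG by (simp add: m_assoc[symmetric])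
      ultimately show "y \<in> (\<lambda>d. x \<otimes> d) ` rep_ker G n \<rho>" by blast
    qed
    then show ?thesis using surj_card_le[OF finK] by blast
  qed
  have "S = (\<Union>w\<in>f ` S. {z \<in> S. f z = w})" by auto
  then have "card S \<le> (\<Sum>w\<in>f ` S. card {z \<in> S. f z = w})"
    using card_UN_le[of "f ` S" "\<lambda>w. {z \<in> S. f z = w}"] finS by simp
  also have "\<dots> \<le> card (f ` S) * card (rep_ker G n \<rho>)"
    using sum_bounded_above[of "f ` S" "\<lambda>w. card {z \<in> S. f z = w}"] fib by simp
  also have "card (f ` S) \<le> k"
  proof -
    have "card (f ` S) \<le> card {z :: complex. z ^ k = 1}"
      using root k finite_roots_unity[of k, where 'a = complex] by (intro card_mono) auto
    also have "\<dots> \<le> k" using card_roots_unity[of k, where 'a = complex] k by simp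
    finally show ?thesis .
  qed
  finally show ?thesis by simp
qed

end

section \<open>Lower central series modulo a normal subgroup\<close>

text \<open>For normal \<open>K\<close> this is the preimage of the lower central series of the
  quotient by \<open>K\<close>, indexed like \<open>lcs\<close>. Adding \<open>K\<close> to the
  generators keeps the whole argument inside \<open>G\<close>.\<close>

fun rel_lcs :: "('a, 'b) monoid_scheme \<Rightarrow> 'a set \<Rightarrow> nat \<Rightarrow> 'a set" where
  "rel_lcs G K 0 = carrier G"
| "rel_lcs G K (Suc i) =
    generate G ({commutator G h g | h g. h \<in> rel_lcs G K i \<and> g \<in> carrier G} \<union> K)"

context group
begin

lemma nat_pow_mem_subgroup:
  "subgroup H G \<Longrightarrow> x \<in> H \<Longrightarrow> x [^] (k::nat) \<in> H"
  by (induction k) (auto simp: subgroup.one_closed subgroup.m_closed)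

lemma rel_lcs_normal:
  assumes K: "K \<lhd> G"
  shows "rel_lcs G K i \<lhd> G"
proof (induction i)
  case 0
  show ?case by (simp add: normal_inv_iff subgroup_self)
next
  case (Suc i)
  let ?S = "{commutator G h g | h g. h \<in> rel_lcs G K i \<and> g \<in> carrier G} \<union> K"
  have sub: "rel_lcs G K i \<subseteq> carrier G" "K \<subseteq> carrier G"
    using Suc K by (auto dest: normal_imp_subgroup subgroup.mem_carrier)
  have "generate G ?S \<lhd> G"
  proof (rule normal_generateI)
    show "?S \<subseteq> carrier G" using sub by auto
    fix s x assume s: "s \<in> ?S" and x: "x \<in> carrier G"
    show "x \<otimes> s \<otimes> inv x \<in> ?S"
    proof (cases "s \<in> K")
      case True
      then show ?thesis using normal_invE(2)[OF K x] by blast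
    next
      case False
      then obtain h g where hg: "s = commutator G h g" "h \<in> rel_lcs G K i" "g \<in> carrier G"
        using s by auto
      then have "x \<otimes> s \<otimes> inv x = commutator G (x \<otimes> h \<otimes> inv x) (x \<otimes> g \<otimes> inv x)"
        using conj_commutator[OF x, of h g] sub by auto
      moreover have "x \<otimes> h \<otimes> inv x \<in> rel_lcs G K i" "x \<otimes> g \<otimes> inv x \<in> carrier G"
        using normal_invE(2)[OF Suc x] hg x by auto
      ultimately show ?thesis by blast
    qed
  qed
  then show ?case by simp
qed

lemma rel_lcs_subgroup: "K \<lhd> G \<Longrightarrow> subgroup (rel_lcs G K i) G"
  using rel_lcs_normal normal_imp_subgroup by blast

lemma rel_lcs_carrier: "K \<lhd> G \<Longrightarrow> rel_lcs G K i \<subseteq> carrier G"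
  using rel_lcs_subgroup subgroup.subset by blast

lemma subset_rel_lcs:
  assumes K: "K \<lhd> G"
  shows "K \<subseteq> rel_lcs G K i"
  using K by (cases i) (auto dest: normal_imp_subgroup subgroup.mem_carrier intro: generate.incl)

lemma commutator_rel_lcs:
  "h \<in> rel_lcs G K i \<Longrightarrow> g \<in> carrier G \<Longrightarrow> commutator G h g \<in> rel_lcs G K (Suc i)"
  by (auto intro!: generate.incl)

lemma rel_lcs_Suc_least:
  assumes "subgroup M G" "K \<subseteq> M"
    and "\<And>h g. h \<in> rel_lcs G K i \<Longrightarrow> g \<in> carrier G \<Longrightarrow> commutator G h g \<in> M"
  shows "rel_lcs G K (Suc i) \<subseteq> M"
  unfolding rel_lcs.simps using assms(2,3) by (intro generate_subgroup_incl[OF _ assms(1)]) auto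

lemma rel_lcs_Suc_subset:
  assumes K: "K \<lhd> G"
  shows "rel_lcs G K (Suc i) \<subseteq> rel_lcs G K i"
proof (induction i)
  case 0
  show ?case unfolding rel_lcs.simps(1) by (rule rel_lcs_carrier[OF K])
next
  case (Suc i)
  show ?case
    using rel_lcs_Suc_least[OF rel_lcs_subgroup[OF K] subset_rel_lcs[OF K], of "Suc i" "Suc i"]
      commutator_rel_lcs Suc by blast
qed

lemma lcs_subset_rel_lcs: "lcs G i \<subseteq> rel_lcs G K i"
proof (induction i)
  case (Suc i)
  have "{h \<otimes> k \<otimes> inv h \<otimes> inv k | h k. h \<in> lcs G i \<and> k \<in> carrier G}
      \<subseteq> {commutator G h g | h g. h \<in> rel_lcs G K i \<and> g \<in> carrier G} \<union> K"
    using Suc by (auto simp: commutator_def)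
  then show ?case unfolding lcs.simps comm_subgroup_def rel_lcs.simps by (rule mono_generate)
qed simp

text \<open>Moving \<open>h\<close> past one factor \<open>g\<close> costs the scalar
  \<open>c\<close> by which the commutator acts, so moving it past \<open>k\<close> factors costs
  \<open>c ^ k\<close>.\<close>

lemma rep_commutator_pow:
  assumes rep: "is_rep G n \<rho>" and g: "g \<in> carrier G" and h: "h \<in> carrier G"
    and cen: "commutator G g h \<in> rep_center G n \<rho>"
  shows "\<rho> (commutator G (g [^] (k::nat)) h) = \<rho> (commutator G g h [^] k)"
proof -
  note C = rep_carrier[OF rep]
  obtain c where c: "\<rho> (commutator G g h) = c \<cdot>\<^sub>m 1\<^sub>m n" using cen by (auto simp: rep_center_def)
  have gh: "\<rho> g * \<rho> h = c \<cdot>\<^sub>m (\<rho> h * \<rho> g)"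
    using rep_commutator[OF rep g h] C[OF g] C[OF h] by (simp add: c smult_one_mat_mult[of _ n])
  have cpow: "\<rho> (commutator G g h [^] k) = c ^ k \<cdot>\<^sub>m 1\<^sub>m n" for k :: nat
  proof (induction k)
    case 0
    show ?case using rep_one[OF rep] by auto
  next
    case (Suc k)
    then show ?case using g h by (auto simp: rep_mult[OF rep] c intro!: eq_matI)
  qed
  have comm: "\<rho> (g [^] k) * \<rho> h = c ^ k \<cdot>\<^sub>m (\<rho> h * \<rho> (g [^] k))" for k :: nat
  proof (induction k)
    case 0
    show ?case using rep_one[OF rep] C[OF h] by auto
  next
    case (Suc k)
    let ?X = "\<rho> (g [^] k)"
    have X: "?X \<in> carrier_mat n n" "\<rho> g \<in> carrier_mat n n" "\<rho> h \<in> carrier_mat n n" using C g h by auto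
    have "\<rho> (g [^] Suc k) * \<rho> h = ?X * (\<rho> g * \<rho> h)"
      using X g by (simp add: rep_mult[OF rep] assoc_mult_mat[of _ n n _ n _ n])
    also have "\<dots> = c \<cdot>\<^sub>m (?X * \<rho> h * \<rho> g)"
      unfolding gh using X by (simp add: mult_smult_distrib[of _ n n _ n] assoc_mult_mat[of _ n n _ n _ n])
    also have "\<dots> = c \<cdot>\<^sub>m (c ^ k \<cdot>\<^sub>m (\<rho> h * (?X * \<rho> g)))"
      unfolding Suc using X by (simp add: mult_smult_assoc_mat[of _ n n _ n] assoc_mult_mat[of _ n n _ n _ n])
    also have "\<dots> = c ^ Suc k \<cdot>\<^sub>m (\<rho> h * \<rho> (g [^] Suc k))"
      using X g by (auto simp: rep_mult[OF rep] intro!: eq_matI)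
    finally show ?case .
  qed
  let ?X = "\<rho> (g [^] k)" and ?A = "\<rho> (commutator G (g [^] k) h)" and ?U = "h \<otimes> g [^] k"
  have U: "?U \<in> carrier G" using g h by simp
  have X: "?X \<in> carrier_mat n n" "\<rho> h \<in> carrier_mat n n" "?A \<in> carrier_mat n n"
    "\<rho> ?U \<in> carrier_mat n n" "\<rho> (inv ?U) \<in> carrier_mat n n" using C g h by auto
  have eq: "?A * \<rho> ?U = c ^ k \<cdot>\<^sub>m \<rho> ?U"
    using rep_commutator[OF rep, of "g [^] k" h] comm[of k] g h by (simp add: rep_mult[OF rep])
  have "?A = ?A * (\<rho> ?U * \<rho> (inv ?U))" using X rep_inv[OF rep U] by simp
  also have "\<dots> = (c ^ k \<cdot>\<^sub>m \<rho> ?U) * \<rho> (inv ?U)"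
    using assoc_mult_mat[OF X(3,4,5)] eq by simp
  also have "\<dots> = c ^ k \<cdot>\<^sub>m 1\<^sub>m n"
    using X rep_inv[OF rep U] by (simp add: mult_smult_assoc_mat[of _ n n _ n])
  finally show ?thesis by (simp add: cpow)
qed

text \<open>Scalar matrices commute, so taking \<open>k\<close>-th powers is multiplicative on the
  center modulo the kernel.\<close>

lemma central_torsion_subgroup:
  assumes rep: "is_rep G n \<rho>"
  shows "subgroup {z \<in> rep_center G n \<rho>. z [^] (k::nat) \<in> rep_ker G n \<rho>} G" (is "subgroup ?E G")
proof -
  have Z: "subgroup (rep_center G n \<rho>) G" and K: "subgroup (rep_ker G n \<rho>) G"
    using rep_center_normal[OF rep] rep_ker_normal[OF rep] normal_imp_subgroup by auto
  have pw: "\<rho> ((x \<otimes> y) [^] k) = \<rho> (x [^] k \<otimes> y [^] k)" if xy: "x \<in> rep_center G n \<rho>" "y \<in> rep_center G n \<rho>" for x y and k :: nat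
  proof -
    obtain c d where cd: "\<rho> x = c \<cdot>\<^sub>m 1\<^sub>m n" "\<rho> y = d \<cdot>\<^sub>m 1\<^sub>m n" "x \<in> carrier G" "y \<in> carrier G"
      using xy by (auto simp: rep_center_def)
    have s: "(e \<cdot>\<^sub>m 1\<^sub>m n) ^\<^sub>m j = e ^ j \<cdot>\<^sub>m 1\<^sub>m n" for e :: complex and j
      by (induction j) (auto intro!: eq_matI)
    have "\<rho> (x \<otimes> y) = (c * d) \<cdot>\<^sub>m 1\<^sub>m n" using cd by (auto simp: rep_mult[OF rep] intro!: eq_matI)
    then show ?thesis
      using cd by (auto simp: rep_mult[OF rep] rep_pow[OF rep] s power_mult_distrib intro!: eq_matI)
  qed
  show ?thesis
  proof (rule subgroupI)
    show "?E \<subseteq> carrier G" by (auto simp: rep_center_def)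
    have "\<one> \<in> ?E" using subgroup.one_closed[OF Z] subgroup.one_closed[OF K] by simp
    then show "?E \<noteq> {}" by blast
    fix x assume x: "x \<in> ?E"
    then have xG: "x \<in> carrier G" by (auto simp: rep_center_def)
    have "inv x [^] k = inv (x [^] k)" using nat_pow_inv[OF xG] by simp
    then show "inv x \<in> ?E"
      using x subgroup.m_inv_closed[OF Z, of x] subgroup.m_inv_closed[OF K, of "x [^] k"] by simp
    fix y assume y: "y \<in> ?E"
    then have "\<rho> ((x \<otimes> y) [^] k) = 1\<^sub>m n"
      using x pw[of x y k] subgroup.m_closed[OF K, of "x [^] k" "y [^] k"] by (auto simp: rep_ker_def)
    then show "x \<otimes> y \<in> ?E"
      using x y subgroup.m_closed[OF Z, of x y] by (auto simp: rep_ker_def rep_center_def)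
  qed
qed

lemma irr_rep_degree_one:
  assumes "is_rep G 1 \<rho>"
  shows "irr_rep G 1 \<rho>"
proof -
  have "W = {0\<^sub>v 1} \<or> W = carrier_vec 1" if W: "is_subspace 1 W" for W
  proof (rule disjCI)
    assume ne: "W \<noteq> carrier_vec 1"
    have "w = 0\<^sub>v 1" if w: "w \<in> W" for w
    proof (rule ccontr)
      assume "w \<noteq> 0\<^sub>v 1"
      moreover have wc: "w \<in> carrier_vec 1" using w W by (auto simp: is_subspace_def)
      ultimately have nz: "w $ 0 \<noteq> 0" by (metis carrier_vecD eq_vecI index_zero_vec less_one)
      have "v \<in> W" if v: "v \<in> carrier_vec 1" for v
      proof -
        have "v = (v $ 0 / w $ 0) \<cdot>\<^sub>v w" using v wc nz by (intro eq_vecI) auto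
        then show ?thesis using W w unfolding is_subspace_def by metis
      qed
      then show False using ne W by (auto simp: is_subspace_def)
    qed
    then show "W = {0\<^sub>v 1}" using W by (auto simp: is_subspace_def)
  qed
  then show ?thesis using assms by (auto simp: irr_rep_def)
qed

lemma commutator_in_ker_degree_one:
  assumes rep: "is_rep G 1 \<rho>" and g: "g \<in> carrier G" and h: "h \<in> carrier G"
  shows "commutator G g h \<in> rep_ker G 1 \<rho>"
proof -
  have "\<rho> g * \<rho> h = \<rho> h * \<rho> g"
    using rep_carrier[OF rep g] rep_carrier[OF rep h] by (intro eq_matI) (auto simp: scalar_prod_def)
  then show ?thesis using commutator_in_ker_iff[OF rep g h] by simp
qed

end

section \<open>Finite \<open>p\<close>-groups: subgroup orders, central elements and descent of the
  series\<close>

locale finite_p_group = fin_group +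
  fixes p m :: nat
  assumes prime: "prime p" and card_carrier: "card (carrier G) = p ^ m"
begin

lemma p_gt_1: "p > 1"
  using prime by (rule prime_gt_1_nat)

lemma dvd_card_carrier: "d dvd card (carrier G) \<Longrightarrow> \<exists>i. d = p ^ i"
  using prime card_carrier by (auto simp: divides_primepow_nat)

lemma card_subgroup:
  assumes "subgroup H G"
  shows "\<exists>i. card H = p ^ i"
  using lagrange[OF assms] dvd_card_carrier by (metis Coset.order_def dvd_triv_right)

lemma card_subgroup_psubset:
  assumes H: "subgroup H G" and L: "subgroup L G" and HL: "H \<subset> L"
  shows "p * card H \<le> card L"
proof -
  obtain i j where ij: "card H = p ^ i" "card L = p ^ j" using card_subgroup H L by blast
  have "card H < card L"
    using HL L fin by (intro psubset_card_mono) (auto intro: finite_subset[OF subgroup.subset])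
  then have "i < j" using ij p_gt_1 by simp
  then have "p ^ Suc i \<le> p ^ j" using p_gt_1 by (intro power_increasing) auto
  then show ?thesis using ij by simp
qed

lemma finite_subgroup: "subgroup H G \<Longrightarrow> finite H"
  using fin finite_subset subgroup.subset by blast

lemma card_subgroup_pos: "subgroup H G \<Longrightarrow> card H > 0"
  using finite_subgroup subgroup.one_closed card_gt_0_iff by blast

text \<open>The class equation: the orbits under conjugation have \<open>p\<close>-power size, and
  if \<open>{\<one>}\<close> were the only one of size 1, the order of the group would be 1 modulo
  \<open>p\<close>.\<close>

lemma exists_central:
  assumes nt: "carrier G \<noteq> {\<one>}"
  shows "\<exists>z \<in> carrier G - {\<one>}. \<forall>g \<in> carrier G. z \<otimes> g = g \<otimes> z"
proof (rule ccontr)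
  assume neg: "\<not> ?thesis"
  let ?\<phi> = "\<lambda>g. (\<lambda>h \<in> carrier G. g \<otimes> h \<otimes> (inv g))"
  interpret act: group_action G "carrier G" ?\<phi> by (rule action_by_conjugation)
  let ?O = "orbits G (carrier G) ?\<phi>"
  have "(\<Sum>orb\<in>?O. card orb) = card (carrier G)"
    using act.disjoint_sum[OF fin, of "\<lambda>_. 1 :: nat"] by simp
  moreover have finO: "finite ?O" using fin by (simp add: orbits_def)
  moreover have "orbit G ?\<phi> \<one> = {\<one>}"
    by (auto simp: orbit_def intro!: exI[of _ "\<one>"])
  then have one: "{\<one>} \<in> ?O" unfolding orbits_def by (auto intro!: exI[of _ "\<one>"])
  ultimately have sum: "card (carrier G) = 1 + (\<Sum>orb\<in>?O - {{\<one>}}. card orb)"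
    by (simp add: sum.remove)
  have "p dvd card orb" if orb: "orb \<in> ?O - {{\<one>}}" for orb
  proof -
    obtain x where x: "x \<in> carrier G" "orb = orbit G ?\<phi> x" using orb by (auto simp: orbits_def)
    have "card (carrier G) = card orb * card (stabilizer G ?\<phi> x)"
      using act.orbit_stabilizer_theorem[OF x(1)] unfolding x(2) Coset.order_def by (rule sym)
    then have "card orb dvd card (carrier G)" by (rule dvdI)
    then obtain i where i: "card orb = p ^ i" using dvd_card_carrier by blast
    have "i \<noteq> 0"
    proof
      assume "i = 0"
      then obtain y where "orb = {y}" using i by (auto simp: card_1_singleton_iff)
      moreover have "x \<in> orb" using act.orbit_refl[OF x(1)] x(2) by simp
      ultimately have ox: "orbit G ?\<phi> x = {x}" using x by simp
      have "x \<otimes> g = g \<otimes> x" if g: "g \<in> carrier G" for g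
      proof -
        have "g \<otimes> x \<otimes> inv g \<in> orbit G ?\<phi> x" using g x(1) by (auto simp: orbit_def intro!: exI[of _ g])
        then have "g \<otimes> x \<otimes> inv g = x" using ox by simp
        then show ?thesis using g x(1) by (metis inv_solve_right m_closed)
      qed
      then have "x = \<one>" using neg x(1) by blast
      then show False using orb ox x(2) by simp
    qed
    then show ?thesis using i by (simp add: dvd_power)
  qed
  then have rest: "p dvd (\<Sum>orb\<in>?O - {{\<one>}}. card orb)" by (rule dvd_sum)
  have "p dvd card (carrier G)"
  proof -
    have "m \<noteq> 0"
    proof
      assume "m = 0"
      then obtain y where y: "carrier G = {y}" using card_carrier by (auto simp: card_1_singleton_iff)
      have "\<one> \<in> {y}" using one_closed unfolding y .
      then show False using nt y by simp
    qed
    then show ?thesis by (simp add: card_carrier dvd_power)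
  qed
  then have "p dvd 1" unfolding sum dvd_add_left_iff[OF rest] .
  then show False using p_gt_1 by simp
qed

lemma exists_central_mod:
  assumes N: "N \<lhd> G" and ne: "N \<noteq> carrier G"
  obtains z where "z \<in> carrier G - N" "\<And>g. g \<in> carrier G \<Longrightarrow> commutator G z g \<in> N"
proof -
  interpret N: normal N G using N .
  let ?Q = "G Mod N"
  have "card (carrier ?Q) * card N = card (carrier G)"
    using lagrange[OF N.subgroup_axioms] by (simp add: FactGroup_def Coset.order_def)
  then obtain k where "card (carrier ?Q) = p ^ k" using dvd_card_carrier by (metis dvd_triv_left)
  then interpret Q: finite_p_group ?Q p k
    using N.factorgroup_is_group fin prime
    by (intro finite_p_group.intro fin_group.intro fin_group_axioms.intro finite_p_group_axioms.intro)
      (auto simp: FactGroup_def RCOSETS_def)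
  have mem: "N #> g \<in> carrier ?Q" if "g \<in> carrier G" for g
    using that by (auto simp: FactGroup_def RCOSETS_def)
  have eqN: "N #> g = N \<longleftrightarrow> g \<in> N" if "g \<in> carrier G" for g
    using that coset_join1[of N g] coset_join2[OF that N.subgroup_axioms] N.subgroup_axioms by auto
  obtain g0 where g0: "g0 \<in> carrier G" "g0 \<notin> N" using ne N.subset by blast
  have oneQ: "\<one>\<^bsub>?Q\<^esub> = N" by (simp add: FactGroup_def)
  have "carrier ?Q \<noteq> {\<one>\<^bsub>?Q\<^esub>}" using mem[OF g0(1)] eqN[OF g0(1)] g0(2) oneQ by auto
  then obtain X where X: "X \<in> carrier ?Q - {\<one>\<^bsub>?Q\<^esub>}"
    "\<And>Y. Y \<in> carrier ?Q \<Longrightarrow> X \<otimes>\<^bsub>?Q\<^esub> Y = Y \<otimes>\<^bsub>?Q\<^esub> X"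
    using Q.exists_central by blast
  then obtain z where z: "z \<in> carrier G" "X = N #> z" by (auto simp: FactGroup_def RCOSETS_def)
  have "commutator G z g \<in> N" if g: "g \<in> carrier G" for g
  proof -
    have "N #> (z \<otimes> g) = N #> (g \<otimes> z)"
      using X(2)[OF mem[OF g]] z g by (simp add: FactGroup_def N.rcos_sum)
    then have "z \<otimes> g \<in> N #> (g \<otimes> z)"
      using rcos_self[of "z \<otimes> g" N] z g N.subgroup_axioms by simp
    then obtain d where d: "d \<in> N" "z \<otimes> g = d \<otimes> (g \<otimes> z)" by (auto simp: r_coset_def)
    then have "commutator G z g \<otimes> (g \<otimes> z) = d \<otimes> (g \<otimes> z)" using commutator_mult z g by simp
    then have "commutator G z g = d"
      using z g N.mem_carrier[OF d(1)] right_cancel[of "g \<otimes> z" "commutator G z g" d] by simp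
    then show ?thesis using d by simp
  qed
  then show thesis using that z X eqN oneQ by blast
qed

text \<open>The quotient by the kernel is a nontrivial \<open>p\<close>-group, and its nontrivial
  center corresponds to \<open>rep_center\<close>.\<close>

lemma rep_ker_psubset_center:
  assumes irr: "irr_rep G n \<rho>" and ne: "rep_ker G n \<rho> \<noteq> carrier G"
  shows "rep_ker G n \<rho> \<subset> rep_center G n \<rho>"
proof -
  note rep = irr_rep_is_rep[OF irr]
  obtain z where "z \<in> carrier G - rep_ker G n \<rho>" "\<And>g. g \<in> carrier G \<Longrightarrow> commutator G z g \<in> rep_ker G n \<rho>"
    using exists_central_mod[OF rep_ker_normal[OF rep] ne] by blast
  then have "z \<in> rep_center G n \<rho>" "z \<notin> rep_ker G n \<rho>" using rep_center_iff[OF irr] by auto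
  then show ?thesis using rep_ker_subset_center[OF rep] by blast
qed

lemma card_ker_center:
  assumes irr: "irr_rep G n \<rho>" and ne: "rep_ker G n \<rho> \<noteq> carrier G"
  shows "p * card (rep_ker G n \<rho>) \<le> card (rep_center G n \<rho>)"
  using card_subgroup_psubset[OF _ _ rep_ker_psubset_center[OF irr ne]]
    rep_ker_normal[OF irr_rep_is_rep[OF irr]] rep_center_normal[OF irr_rep_is_rep[OF irr]]
    normal_imp_subgroup by blast

text \<open>If the series stabilises at \<open>H \<noteq> K\<close>, a normal subgroup that is maximal subject to
  containing \<open>K\<close> but not \<open>H\<close> is the kernel of an irreducible representation whose center
  is larger, hence contains \<open>H\<close>; so \<open>[H, G]\<close> lies in that kernel.\<close>
lemma rel_lcs_strict:
  assumes K: "K \<lhd> G" and ne: "rel_lcs G K i \<noteq> K"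
  shows "rel_lcs G K (Suc i) \<subset> rel_lcs G K i"
proof (rule ccontr)
  let ?H = "rel_lcs G K i"
  assume "\<not> rel_lcs G K (Suc i) \<subset> ?H"
  then have eq: "rel_lcs G K (Suc i) = ?H" using rel_lcs_Suc_subset[OF K, of i] by blast
  define good where "good M \<longleftrightarrow> M \<lhd> G \<and> K \<subseteq> M \<and> \<not> ?H \<subseteq> M" for M
  have "good K" using K ne subset_rel_lcs[OF K, of i] by (auto simp: good_def)
  moreover have "card M \<le> card (carrier G)" if "good M" for M
    using subgroup.subset[OF normal_imp_subgroup[of M G]] that fin
    by (intro card_mono) (auto simp: good_def)
  ultimately have "\<exists>M. good M \<and> (\<forall>M'. good M' \<longrightarrow> card M' \<le> card M)"
    by (intro ex_has_greatest_nat[of good K card "Suc (card (carrier G))"]) (auto simp: less_Suc_eq_le)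
  then obtain M where M: "good M" and max: "\<And>M'. good M' \<Longrightarrow> card M' \<le> card M" by blast
  then have "\<not> ?H \<subseteq> M" by (simp add: good_def)
  then obtain h where h: "h \<in> ?H" "h \<notin> M" by blast
  have hG: "h \<in> carrier G" using h rel_lcs_carrier[OF K] by blast
  obtain n \<rho> where irr: "irr_rep G n \<rho>" and Mk: "M \<subseteq> rep_ker G n \<rho>" and hk: "h \<notin> rep_ker G n \<rho>"
    using separating_irr_rep[of M h] M hG h(2) unfolding good_def by metis
  note rep = irr_rep_is_rep[OF irr]
  have kn: "rep_ker G n \<rho> \<lhd> G" and zn: "rep_center G n \<rho> \<lhd> G"
    using rep_ker_normal[OF rep] rep_center_normal[OF rep] .
  have "rep_ker G n \<rho> \<noteq> carrier G" using hk hG by blast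
  then have ps: "rep_ker G n \<rho> \<subset> rep_center G n \<rho>" using rep_ker_psubset_center[OF irr] by blast
  then have "card M < card (rep_center G n \<rho>)"
    using Mk finite_subgroup[OF normal_imp_subgroup[OF zn]] by (intro psubset_card_mono) auto
  then have "\<not> good (rep_center G n \<rho>)" using max by (meson not_le)
  then have Hz: "?H \<subseteq> rep_center G n \<rho>" using M Mk ps zn by (auto simp: good_def)
  have Kk: "K \<subseteq> rep_ker G n \<rho>" using M Mk by (auto simp: good_def)
  have "rel_lcs G K (Suc i) \<subseteq> rep_ker G n \<rho>"
    using rel_lcs_Suc_least[OF normal_imp_subgroup[OF kn] Kk] rep_center_commutator[OF rep] Hz by blast
  then show False using eq h hk by auto
qed

text \<open>Each step divides the order by at least \<open>p\<close> until \<open>K\<close> is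
  reached, and the series stays at \<open>K\<close> afterwards.\<close>

lemma rel_lcs_reaches:
  assumes K: "K \<lhd> G" and "card (rel_lcs G K i) \<le> p ^ j * card K"
  shows "rel_lcs G K (i + j) = K"
  using assms(2)
proof (induction j arbitrary: i)
  case 0
  have "K = rel_lcs G K i"
    using 0 subset_rel_lcs[OF K, of i] finite_subgroup[OF rel_lcs_subgroup[OF K]]
    by (intro card_seteq) auto
  then show ?case by simp
next
  case (Suc j)
  have le: "card (rel_lcs G K (Suc i)) \<le> p ^ j * card K"
  proof (cases "rel_lcs G K i = K")
    case True
    then have "rel_lcs G K (Suc i) = K"
      using rel_lcs_Suc_subset[OF K, of i] subset_rel_lcs[OF K, of "Suc i"] by blast
    then show ?thesis using p_gt_1 by simp
  next
    case False
    have "p * card (rel_lcs G K (Suc i)) \<le> card (rel_lcs G K i)"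
      using card_subgroup_psubset[OF _ _ rel_lcs_strict[OF K False]] rel_lcs_subgroup[OF K] by blast
    also have "\<dots> \<le> p * (p ^ j * card K)" using Suc.prems by (simp add: mult.assoc)
    finally show ?thesis using p_gt_1 by simp
  qed
  show ?case using Suc.IH[OF le] by simp
qed

text \<open>The chain of iterated \<open>p\<close>-th powers of \<open>x\<close> starts outside
  \<open>K\<close> and ends at \<open>\<one>\<close>, so it enters \<open>K\<close> at some step.
  This supplies an element of order \<open>p\<close> modulo \<open>K\<close>.\<close>

lemma exists_pth_power_in:
  assumes K: "subgroup K G" and x: "x \<in> carrier G" "x \<notin> K"
  obtains j :: nat where "x [^] (p ^ j) \<notin> K" "(x [^] (p ^ j)) [^] p \<in> K"
proof -
  have "x [^] (p ^ m) = \<one>"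
    using pow_order_eq_1[OF x(1)] by (simp add: Coset.order_def card_carrier)
  then have "x [^] (p ^ m) \<in> K" using subgroup.one_closed[OF K] by simp
  moreover have "x [^] (p ^ 0) \<notin> K" using x by simp
  ultimately obtain j where "x [^] (p ^ j) \<notin> K" "x [^] (p ^ Suc j) \<in> K"
    using inc_induct[of 0 m "\<lambda>j. x [^] (p ^ j) \<in> K"] by blast
  then show thesis using that x by (simp add: nat_pow_pow mult.commute)
qed

end

section \<open>Codegrees of \<open>p\<close>-groups\<close>

context finite_p_group
begin

lemma card_normal_pos: "N \<lhd> G \<Longrightarrow> card N > 0"
  using card_subgroup_pos normal_imp_subgroup by blast

text \<open>Combine \<open>n^2 |Z| \<le> |G|\<close> with \<open>|Z| \<ge> p |K|\<close> and cancel
  \<open>n |K|\<close>. Here and below, codegree \<open>p^e\<close> is stated in product form, which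
  avoids division.\<close>

lemma degree_bound:
  assumes irr: "irr_rep G n \<rho>" and ne: "rep_ker G n \<rho> \<noteq> carrier G"
    and cod: "card (carrier G) = p ^ e * n * card (rep_ker G n \<rho>)"
  shows "n * p \<le> p ^ e"
proof -
  let ?K = "card (rep_ker G n \<rho>)"
  have K: "?K > 0" using card_normal_pos rep_ker_normal[OF irr_rep_is_rep[OF irr]] by blast
  have "n * (n * (p * ?K)) \<le> n * (n * card (rep_center G n \<rho>))"
    using card_ker_center[OF irr ne] by (intro mult_le_mono2)
  also have "\<dots> \<le> p ^ e * n * ?K"
    using degree_square_center_le[OF irr] cod by (simp add: power2_eq_square mult.assoc)
  finally have "(n * p) * (n * ?K) \<le> p ^ e * (n * ?K)" by (simp add: algebra_simps)
  then show ?thesis using K irr_rep_pos[OF irr] by simp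
qed

text \<open>This is \<open>|G : K| \<le> p^(2e - 1)\<close> without subtraction in the exponent; the
  degree bound is inserted into the order formula.\<close>

lemma card_carrier_bound:
  assumes irr: "irr_rep G n \<rho>" and ne: "rep_ker G n \<rho> \<noteq> carrier G"
    and cod: "card (carrier G) = p ^ e * n * card (rep_ker G n \<rho>)"
  shows "card (carrier G) * p \<le> p ^ (2 * e) * card (rep_ker G n \<rho>)"
proof -
  have "card (carrier G) * p = p ^ e * (n * p) * card (rep_ker G n \<rho>)"
    using cod by (simp add: algebra_simps)
  also have "\<dots> \<le> p ^ e * p ^ e * card (rep_ker G n \<rho>)"
    using degree_bound[OF assms] by (intro mult_le_mono1 mult_le_mono2)
  finally show ?thesis by (simp add: mult_2 power_add)
qed

lemma degree_ge_2:
  assumes irr: "irr_rep G n \<rho>" and g: "g \<in> carrier G" and h: "h \<in> carrier G"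
    and nc: "commutator G g h \<notin> rep_ker G n \<rho>"
  shows "n \<ge> 2"
proof (rule ccontr)
  assume "\<not> n \<ge> 2"
  then have "n = 1" using irr_rep_pos[OF irr] by simp
  then show False using commutator_in_ker_degree_one[of \<rho> g h] irr_rep_is_rep[OF irr] g h nc by simp
qed

text \<open>For \<open>e \<le> 1\<close> the degree bound gives \<open>n = 1\<close>, but
  representations of degree 1 kill all commutators. This excludes the codegrees 1 and
  \<open>p\<close>.\<close>

lemma nonlinear_codegree:
  assumes irr: "irr_rep G n \<rho>" and g: "g \<in> carrier G" and h: "h \<in> carrier G"
    and nc: "commutator G g h \<notin> rep_ker G n \<rho>"
    and cod: "card (carrier G) = p ^ e * n * card (rep_ker G n \<rho>)"
  shows "e \<ge> 2"
proof (rule ccontr)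
  assume "\<not> e \<ge> 2"
  then have "p ^ e \<le> p ^ 1" using p_gt_1 by (intro power_increasing) auto
  moreover have "rep_ker G n \<rho> \<noteq> carrier G" using nc commutator_closed[OF g h] by metis
  ultimately have "n * p \<le> 1 * p" using degree_bound[OF irr _ cod] by fastforce
  then have "n \<le> 1" using p_gt_1 by simp
  then show False using degree_ge_2[OF irr g h nc] by simp
qed

text \<open>Some power of an element of the center outside the kernel has order \<open>p\<close>
  modulo the kernel, so the torsion subgroup contains the kernel properly.\<close>

lemma torsion_ge:
  assumes rep: "is_rep G n \<rho>" and ps: "rep_ker G n \<rho> \<subset> rep_center G n \<rho>"
  shows "p * card (rep_ker G n \<rho>) \<le> card {z \<in> rep_center G n \<rho>. z [^] p \<in> rep_ker G n \<rho>}"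
proof -
  let ?E = "{z \<in> rep_center G n \<rho>. z [^] p \<in> rep_ker G n \<rho>}"
  have K: "subgroup (rep_ker G n \<rho>) G" and Z: "subgroup (rep_center G n \<rho>) G"
    using rep_ker_normal[OF rep] rep_center_normal[OF rep] normal_imp_subgroup by auto
  obtain x where x: "x \<in> rep_center G n \<rho>" "x \<notin> rep_ker G n \<rho>" using ps by blast
  have "x \<in> carrier G" using x by (auto simp: rep_center_def)
  then obtain j :: nat where j: "x [^] (p ^ j) \<notin> rep_ker G n \<rho>" "(x [^] (p ^ j)) [^] p \<in> rep_ker G n \<rho>"
    using exists_pth_power_in[OF K _ x(2)] by blast
  have "x [^] (p ^ j) \<in> ?E" using j nat_pow_mem_subgroup[OF Z x(1)] by blast
  moreover have "rep_ker G n \<rho> \<subseteq> ?E"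
    using rep_ker_subset_center[OF rep] nat_pow_mem_subgroup[OF K] by blast
  ultimately have "rep_ker G n \<rho> \<subset> ?E" using j by blast
  then show ?thesis using card_subgroup_psubset[OF K central_torsion_subgroup[OF rep]] by blast
qed

text \<open>If \<open>x\<^sup>p \<notin> N\<close>, some linear character \<open>\<lambda>\<close> over \<open>N\<close> has order at least \<open>p\<^sup>2\<close>,
  and then the codegrees of \<open>\<lambda>\<close> and of \<open>\<lambda>\<^sup>p\<close> differ by a factor \<open>p\<close>.\<close>
lemma pth_power_mem:
  assumes N: "N \<lhd> G" and comm: "\<And>g h. g \<in> carrier G \<Longrightarrow> h \<in> carrier G \<Longrightarrow> commutator G g h \<in> N"
    and cods: "\<And>n \<rho>. irr_rep G n \<rho> \<Longrightarrow> N \<subseteq> rep_ker G n \<rho> \<Longrightarrow>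
      \<exists>e \<in> {0, 1, b}. card (carrier G) = p ^ e * n * card (rep_ker G n \<rho>)"
    and b: "b > 2" and x: "x \<in> carrier G"
  shows "x [^] p \<in> N"
proof (rule ccontr)
  assume "x [^] p \<notin> N"
  then obtain n \<rho> where irr: "irr_rep G n \<rho>" and Nk: "N \<subseteq> rep_ker G n \<rho>"
    and xk: "x [^] p \<notin> rep_ker G n \<rho>"
    using separating_irr_rep[OF N, of "x [^] p"] x by blast
  note rep = irr_rep_is_rep[OF irr] and npos = irr_rep_pos[OF irr]
  let ?K = "rep_ker G n \<rho>"
  have K: "subgroup ?K G" using rep_ker_normal[OF rep] normal_imp_subgroup by auto
  have Kpos: "card ?K > 0" using card_subgroup_pos[OF K] .
  have cen: "rep_center G n \<rho> = carrier G"
    \<comment> \<open>Modulo \<open>N\<close> the group is abelian, so every element acts as a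
      scalar; the inequality between degree and center then forces degree 1.\<close>
    using rep_center_iff[OF irr] comm Nk by blast
  have "n\<^sup>2 * card (carrier G) \<le> 1 * card (carrier G)" using degree_square_center_le[OF irr] cen by simp
  then have "n\<^sup>2 \<le> 1" using order_pos by (simp only: mult_le_cancel2)
  then have n1: "n = 1" using npos power2_nat_le_imp_le[of n 1] by simp
  define f where "f g = \<rho> g $$ (0, 0)" for g
  have scal: "\<rho> g = f g \<cdot>\<^sub>m 1\<^sub>m 1" if "g \<in> carrier G" for g
    using rep_carrier[OF rep that] n1 by (intro eq_matI) (auto simp: f_def)
  have f_mult: "f (g \<otimes> h) = f g * f h" if "g \<in> carrier G" "h \<in> carrier G" for g h
    using that rep_mult[OF rep that] scal[of g] scal[of h] by (simp add: f_def[of "g \<otimes> h"])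
  have f_one: "f \<one> = 1" using rep_one[OF rep] n1 by (simp add: f_def)
  have f_pow: "f (g [^] k) = f g ^ k" if "g \<in> carrier G" for g and k :: nat
    using that by (induction k) (auto simp: f_one f_mult)
  have ker: "g \<in> ?K \<longleftrightarrow> g \<in> carrier G \<and> f g = 1" for g
    using scal[of g] smult_mat_eq_one_iff[of 1 "f g"] n1 by (auto simp: rep_ker_def)
  \<comment> \<open>The \<open>p\<close>-th power of the linear character \<open>f\<close>. Its
    kernel consists of the elements whose \<open>p\<close>-th power lies in \<open>?K\<close>, and
    it has index \<open>p\<close> over \<open>?K\<close>.\<close>
  define \<sigma> where "\<sigma> g = (f g ^ p) \<cdot>\<^sub>m (1\<^sub>m 1 :: complex mat)" for g
  have "is_rep G 1 \<sigma>"
    unfolding is_rep_def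
  proof (intro conjI ballI)
    fix g h assume "g \<in> carrier G" "h \<in> carrier G"
    then show "\<sigma> (g \<otimes> h) = \<sigma> g * \<sigma> h"
      by (intro eq_matI) (auto simp: \<sigma>_def f_mult power_mult_distrib)
  qed (auto simp: \<sigma>_def f_one)
  then have irr\<sigma>: "irr_rep G 1 \<sigma>" by (rule irr_rep_degree_one)
  let ?K' = "rep_ker G 1 \<sigma>"
  have ker\<sigma>: "g \<in> ?K' \<longleftrightarrow> g \<in> carrier G \<and> f g ^ p = 1" for g
  proof -
    have "\<sigma> g = 1\<^sub>m 1 \<longleftrightarrow> f g ^ p = 1" unfolding \<sigma>_def by (rule smult_mat_eq_one_iff) simp
    then show ?thesis unfolding rep_ker_def by blast
  qed
  have K': "?K' = {z \<in> rep_center G n \<rho>. z [^] p \<in> ?K}"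
    unfolding cen
    by (auto simp only: ker\<sigma> ker f_pow nat_pow_closed mem_Collect_eq)
  have "rep_center G n \<rho> \<noteq> ?K" using xk x unfolding cen by (metis nat_pow_closed)
  then have ge: "p * card ?K \<le> card ?K'"
    unfolding K' using torsion_ge[OF rep] rep_ker_subset_center[OF rep] by blast
  have "card ?K' \<le> p * card ?K"
    unfolding K' using p_gt_1 by (intro card_central_le[OF rep npos]) auto
  then have eq: "card ?K' = p * card ?K" using ge by simp
  have "N \<subseteq> ?K'" using Nk nat_pow_mem_subgroup[OF K] cen subgroup.subset[OF K] unfolding K' by blast
  then obtain e' where e': "e' \<in> {0, 1, b}" "card (carrier G) = p ^ e' * 1 * card ?K'"
    using cods[OF irr\<sigma>] by blast
  obtain e where e: "e \<in> {0, 1, b}" "card (carrier G) = p ^ e * n * card ?K"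
    using cods[OF irr Nk] by blast
  have "p ^ e * card ?K = p ^ Suc e' * card ?K" using e(2) e'(2) eq n1 by (auto simp: mult.commute)
  then have "p ^ e = p ^ Suc e'" using Kpos by simp
  then have "e = Suc e'" using p_gt_1 by (simp only: power_inject_exp)
  \<comment> \<open>Two consecutive members of \<open>{0, 1, b}\<close> can only be 0 and 1 because
    \<open>b > 2\<close>; for \<open>b = 2\<close> the pair 1, 2 would also occur. So
    \<open>\<sigma>\<close> is trivial, although \<open>x [^] p\<close> is outside
    \<open>?K\<close>.\<close>
  then have "e' = 0" using e(1) e'(1) b by auto
  then have "card ?K' = card (carrier G)" using e'(2) by simp
  then have "?K' = carrier G" using fin by (intro card_seteq) (auto simp: rep_ker_def)
  then have "x \<in> {z \<in> rep_center G n \<rho>. z [^] p \<in> ?K}" using K' x by blast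
  then show False using xk by simp
qed

text \<open>The codegree hypothesis concerns representations trivial on
  \<open>rel_lcs G K0 3\<close>, those of a quotient of class exactly 3. Read contrapositively, the
  lemma yields one of the remaining codegree \<open>p^a\<close> with that term in its
  kernel.\<close>

lemma class_three_quotient_contradiction:
  assumes K0: "K0 \<lhd> G" and ne: "rel_lcs G K0 2 \<noteq> K0" and b: "b \<ge> 2"
    and cods: "\<And>n \<rho>. irr_rep G n \<rho> \<Longrightarrow> rel_lcs G K0 3 \<subseteq> rep_ker G n \<rho> \<Longrightarrow>
      \<exists>e \<in> {0, 1, b}. card (carrier G) = p ^ e * n * card (rep_ker G n \<rho>)"
  shows False
proof -
  define L where "L = rel_lcs G K0"
  have LN: "L i \<lhd> G" for i unfolding L_def by (rule rel_lcs_normal[OF K0])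
  have LK: "K0 \<subseteq> L i" for i unfolding L_def by (rule subset_rel_lcs[OF K0])
  have LG: "L i \<subseteq> carrier G" for i unfolding L_def by (rule rel_lcs_carrier[OF K0])
  have Lcomm: "commutator G h g \<in> L (Suc i)" if "h \<in> L i" "g \<in> carrier G" for h g i
    using that unfolding L_def by (rule commutator_rel_lcs)
  have Lleast: "L (Suc i) \<subseteq> M" if "subgroup M G" "K0 \<subseteq> M"
    "\<And>h g. h \<in> L i \<Longrightarrow> g \<in> carrier G \<Longrightarrow> commutator G h g \<in> M" for M i
    using that unfolding L_def by (rule rel_lcs_Suc_least)
  have Ldec: "L (Suc i) \<subseteq> L i" for i unfolding L_def by (rule rel_lcs_Suc_subset[OF K0])
  have L0: "L 0 = carrier G" by (simp add: L_def)
  have "L (Suc 2) \<subset> L 2" using rel_lcs_strict[OF K0 ne] by (simp only: L_def)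
  then obtain x where x: "x \<in> L 2" "x \<notin> L 3" by (auto simp: eval_nat_numeral)
  have L12: "L 2 \<subseteq> L 1" "L 3 \<subseteq> L 2" using Ldec[of 1] Ldec[of 2] by (simp_all add: eval_nat_numeral)
  have xG: "x \<in> carrier G" using x LG by blast
  obtain n \<chi> where irr: "irr_rep G n \<chi>" and Lk: "L 3 \<subseteq> rep_ker G n \<chi>" and xk: "x \<notin> rep_ker G n \<chi>"
    using separating_irr_rep[OF LN xG x(2)] by blast
  note rep = irr_rep_is_rep[OF irr]
  let ?K = "rep_ker G n \<chi>" and ?Z = "rep_center G n \<chi>"
  have Ksub: "subgroup ?K G" and Zsub: "subgroup ?Z G"
    using rep_ker_normal[OF rep] rep_center_normal[OF rep] normal_imp_subgroup by auto
  have KZ: "?K \<subseteq> ?Z" by (rule rep_ker_subset_center[OF rep])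
  have K0K: "K0 \<subseteq> ?K" using LK Lk by blast
  have L2Z: "L 2 \<subseteq> ?Z"
  proof
    fix h assume h: "h \<in> L 2"
    have "commutator G h g \<in> ?K" if "g \<in> carrier G" for g
      using Lcomm[OF h that] Lk by (auto simp: eval_nat_numeral)
    then show "h \<in> ?Z" using rep_center_iff[OF irr] h LG by blast
  qed
  \<comment> \<open>If the quotient by \<open>?Z\<close> were abelian, then
    \<open>L 1 \<subseteq> ?Z\<close> and hence \<open>L 2 \<subseteq> ?K\<close>, contrary to the
    choice of \<open>x\<close>. A noncentral commutator is what makes the next representation
    nonlinear.\<close>
  have "\<exists>g h. g \<in> carrier G \<and> h \<in> carrier G \<and> commutator G g h \<notin> ?Z"
  proof (rule ccontr)
    assume "\<not> ?thesis"
    then have "L 1 \<subseteq> ?Z" using Lleast[OF Zsub, of 0] K0K KZ L0 by auto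
    then have "L 2 \<subseteq> ?K"
      using Lleast[OF Ksub K0K, of 1] rep_center_commutator[OF rep] by (auto simp: eval_nat_numeral)
    then show False using x xk by blast
  qed
  then obtain u v where uv: "u \<in> carrier G" "v \<in> carrier G" "commutator G u v \<notin> ?Z" by blast
  obtain m \<psi> where irr\<psi>: "irr_rep G m \<psi>" and Zk: "?Z \<subseteq> rep_ker G m \<psi>"
    and uvk: "commutator G u v \<notin> rep_ker G m \<psi>"
    using separating_irr_rep[OF rep_center_normal[OF rep], of "commutator G u v"] uv by auto
  note rep\<psi> = irr_rep_is_rep[OF irr\<psi>]
  let ?D = "rep_ker G m \<psi>" and ?Y = "rep_center G m \<psi>"
  have Dsub: "subgroup ?D G" and Ysub: "subgroup ?Y G"
    using rep_ker_normal[OF rep\<psi>] rep_center_normal[OF rep\<psi>] normal_imp_subgroup by auto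
  have DY: "?D \<subseteq> ?Y" by (rule rep_ker_subset_center[OF rep\<psi>])
  have uvK: "commutator G u v \<notin> ?K" using uv KZ by blast
  obtain e where e: "e \<in> {0, 1, b}" "card (carrier G) = p ^ e * n * card ?K"
    using cods[OF irr] Lk unfolding L_def by blast
  have "e \<ge> 2" using nonlinear_codegree[OF irr uv(1,2) uvK e(2)] .
  then have cod\<chi>: "card (carrier G) = p ^ b * n * card ?K" using e by auto
  have L3D: "L 3 \<subseteq> ?D" using Lk KZ Zk by blast
  obtain e' where e': "e' \<in> {0, 1, b}" "card (carrier G) = p ^ e' * m * card ?D"
    using cods[OF irr\<psi>] L3D unfolding L_def by blast
  have "e' \<ge> 2" using nonlinear_codegree[OF irr\<psi> uv(1,2) uvk e'(2)] .
  then have cod\<psi>: "card (carrier G) = p ^ b * m * card ?D" using e' by auto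
  \<comment> \<open>Commutators of elements of \<open>L 1\<close> lie in
    \<open>L 2 \<subseteq> ?Z \<subseteq> ?D\<close>, so \<open>\<psi>\<close> has class 2 and
    vanishes off \<open>?Y\<close>.\<close>
  have commY: "commutator G g h \<in> ?Y" if "g \<in> carrier G" "h \<in> carrier G" for g h
  proof -
    have "commutator G g h \<in> L 1" using Lcomm[of g 0 h] that L0 by simp
    then have "commutator G (commutator G g h) k \<in> L 2" if "k \<in> carrier G" for k
      using Lcomm[of _ 1 k] that by (simp add: eval_nat_numeral)
    then show ?thesis using rep_center_iff[OF irr\<psi>] that L2Z Zk by auto
  qed
  have sqY: "m\<^sup>2 * card ?Y = card (carrier G)"
    using degree_square_center_eq[OF irr\<psi>] trace_eq_0_if_commutators_central[OF irr\<psi>] commY by blast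
  have pos: "n > 0" "m > 0" "card ?K > 0" "card ?Z > 0" "card ?D > 0" "p ^ b > 0"
    using irr_rep_pos[OF irr] irr_rep_pos[OF irr\<psi>] card_subgroup_pos Ksub Zsub Dsub p_gt_1 by auto
  have mY: "m * card ?Y = p ^ b * card ?D"
    using sqY cod\<psi> pos by (simp add: power2_eq_square)
  have "n * (n * card ?Z) \<le> n * (p ^ b * card ?K)"
    using degree_square_center_le[OF irr] cod\<chi> by (simp add: power2_eq_square algebra_simps)
  then have nZ: "n * card ?Z \<le> p ^ b * card ?K" using pos by simp
  have "p ^ b * (n * card ?K) = p ^ b * (m * card ?D)" using cod\<chi> cod\<psi> by (simp only: mult.assoc)
  then have nK: "n * card ?K = m * card ?D" by (simp only: nat_mult_eq_cancel1[OF pos(6)])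
  \<comment> \<open>Since both codegrees are \<open>p ^ b\<close>, \<open>n |K| = m |D|\<close>.
    This eliminates the two degrees from the inequality for \<open>\<chi>\<close> and the equality
    for \<open>\<psi>\<close>.\<close>
  have key: "card ?Z * (card ?D)\<^sup>2 \<le> (card ?K)\<^sup>2 * card ?Y"
  proof -
    have "p ^ b * (card ?Z * (card ?D)\<^sup>2) = card ?Z * card ?D * (p ^ b * card ?D)"
      by (simp add: power2_eq_square algebra_simps)
    also have "\<dots> = card ?Z * (m * card ?D) * card ?Y" by (simp add: mY[symmetric])
    also have "\<dots> = (n * card ?Z) * card ?K * card ?Y" by (simp add: nK[symmetric])
    also have "\<dots> \<le> (p ^ b * card ?K) * card ?K * card ?Y" using nZ by (intro mult_le_mono1)
    also have "\<dots> = p ^ b * ((card ?K)\<^sup>2 * card ?Y)" by (simp add: power2_eq_square)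
    finally show ?thesis by (simp only: nat_mult_le_cancel1[OF pos(6)])
  qed
  have KZne: "?K \<subset> ?Z" using KZ x xk L2Z by blast
  have pKZ: "p * card ?K \<le> card ?Z" by (rule card_subgroup_psubset[OF Ksub Zsub KZne])
  have ZD: "card ?Z \<le> card ?D" using Zk finite_subgroup[OF Dsub] by (rule card_mono[rotated])
  \<comment> \<open>Otherwise \<open>key\<close> gives \<open>|Z| |D| \<le> p |K|^2\<close>, while
    \<open>|D| \<ge> |Z| \<ge> p |K|\<close> makes the product at least
    \<open>p^2 |K|^2\<close>.\<close>
  have bound: "p * card ?D < card ?Y"
  proof (rule ccontr)
    assume "\<not> p * card ?D < card ?Y"
    then have le: "(card ?K)\<^sup>2 * card ?Y \<le> (card ?K)\<^sup>2 * (p * card ?D)" by simp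
    have "card ?D * (card ?Z * card ?D) = card ?Z * (card ?D)\<^sup>2" by (simp add: power2_eq_square)
    also have "\<dots> \<le> (card ?K)\<^sup>2 * (p * card ?D)" using key le by (rule order_trans)
    also have "\<dots> = card ?D * (p * (card ?K)\<^sup>2)" by simp
    finally have "card ?Z * card ?D \<le> p * (card ?K)\<^sup>2" by (simp only: nat_mult_le_cancel1[OF pos(5)])
    moreover have "(p * card ?K) * (p * card ?K) \<le> card ?Z * card ?D"
      using pKZ ZD by (intro mult_le_mono) auto
    ultimately have "(p * card ?K) * (p * card ?K) \<le> (p * card ?K) * card ?K"
      by (simp only: power2_eq_square mult.assoc)
    moreover have "p * card ?K > 0" using p_gt_1 pos by simp
    ultimately have "p * card ?K \<le> 1 * card ?K" by simp
    then show False using p_gt_1 pos by simp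
  qed
  \<comment> \<open>For \<open>b = 2\<close> this is immediate from \<open>mY\<close>. For
    \<open>b > 2\<close>, \<open>p\<close>-th powers lie in \<open>L 1 \<subseteq> ?Y\<close>, so
    \<open>[g, h]^p\<close> agrees modulo \<open>?D\<close> with \<open>[g^p, h]\<close>, which is
    in \<open>?D\<close>; thus the group has exponent dividing \<open>p^2\<close> modulo
    \<open>?D\<close>.\<close>
  have YD2: "card ?Y \<le> p\<^sup>2 * card ?D"
  proof (cases "b = 2")
    case True
    then have "m * card ?Y = p\<^sup>2 * card ?D" using mY by simp
    moreover have "1 * card ?Y \<le> m * card ?Y" using pos by (intro mult_le_mono1) simp
    ultimately show ?thesis by simp
  next
    case False
    have L1N: "L 1 \<lhd> G" by (rule LN)
    let ?E = "{z \<in> ?Y. z [^] p \<in> ?D}"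
    have commL1: "commutator G g h \<in> L 1" if "g \<in> carrier G" "h \<in> carrier G" for g h
      using Lcomm[of g 0 h] that L0 by simp
    have pL1: "g [^] p \<in> L 1" if g: "g \<in> carrier G" for g
    proof (rule pth_power_mem[OF L1N commL1])
      show "\<exists>e \<in> {0, 1, b}. card (carrier G) = p ^ e * k * card (rep_ker G k \<rho>)"
        if "irr_rep G k \<rho>" "L 1 \<subseteq> rep_ker G k \<rho>" for k \<rho>
        using cods[OF that(1)] that(2) L12 unfolding L_def by blast
    qed (use b False g in auto)
    have K0D: "K0 \<subseteq> ?D" using K0K KZ Zk by blast
    have L1Y: "L 1 \<subseteq> ?Y" using Lleast[OF Ysub, of 0] K0D DY commY L0 by auto
    have "L (Suc 0) \<subseteq> ?E"
    proof (rule Lleast[OF central_torsion_subgroup[OF rep\<psi>]])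
      show "K0 \<subseteq> ?E" using K0D DY nat_pow_mem_subgroup[OF Dsub] by blast
      fix g h assume "g \<in> L 0" and h: "h \<in> carrier G"
      then have g: "g \<in> carrier G" using L0 by simp
      have "g [^] p \<in> ?Y" using pL1[OF g] L1Y by blast
      then have "commutator G (g [^] p) h \<in> ?D" using rep_center_commutator[OF rep\<psi> _ h] by blast
      then have "commutator G g h [^] p \<in> ?D"
        using rep_commutator_pow[OF rep\<psi> g h commY[OF g h], of p] g h by (simp add: rep_ker_def)
      then show "commutator G g h \<in> ?E" using commY[OF g h] by blast
    qed
    then have "(z [^] p) [^] p \<in> ?D" if "z \<in> carrier G" for z using pL1[OF that] by auto
    then have "z [^] (p\<^sup>2) \<in> ?D" if "z \<in> ?Y" for z
      using that by (auto simp: rep_center_def nat_pow_pow power2_eq_square)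
    then show ?thesis using p_gt_1 irr_rep_pos[OF irr\<psi>]
      by (intro card_central_le[OF rep\<psi>]) auto
  qed
  \<comment> \<open>The upper bound on \<open>|Y|\<close> turns \<open>key\<close> into
    \<open>|Z| |D| \<le> (p |K|)^2\<close>, so the lower bounds
    \<open>p |K| \<le> |Z| \<le> |D|\<close> are equalities.\<close>
  have Deq: "card ?Z = p * card ?K \<and> card ?Z = card ?D"
  proof -
    have "card ?D * (card ?Z * card ?D) = card ?Z * (card ?D)\<^sup>2" by (simp add: power2_eq_square)
    also have "\<dots> \<le> (card ?K)\<^sup>2 * card ?Y" by (rule key)
    also have "\<dots> \<le> (card ?K)\<^sup>2 * (p\<^sup>2 * card ?D)" using YD2 by simp
    also have "\<dots> = card ?D * ((p * card ?K) * (p * card ?K))" by (simp add: power2_eq_square algebra_simps)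
    finally have le: "card ?Z * card ?D \<le> (p * card ?K) * (p * card ?K)"
      by (simp only: nat_mult_le_cancel1[OF pos(5)])
    have pK: "p * card ?K > 0" using pos p_gt_1 by simp
    have "(p * card ?K) * card ?D \<le> card ?Z * card ?D" using pKZ by (rule mult_le_mono1)
    with le have "(p * card ?K) * card ?D \<le> (p * card ?K) * (p * card ?K)" by linarith
    then have "card ?D \<le> p * card ?K" by (simp only: nat_mult_le_cancel1[OF pK])
    then show ?thesis using pKZ ZD by linarith
  qed
  have ZeqD: "?Z = ?D" using Deq Zk finite_subgroup[OF Dsub] by (intro card_seteq) auto
  let ?F = "{z \<in> ?Z. z [^] p \<in> ?K}"
  have "card ?Z \<le> card ?F" using torsion_ge[OF rep KZne] Deq by simp
  then have FZ: "?F = ?Z" using finite_subgroup[OF Zsub] by (intro card_seteq) auto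
  \<comment> \<open>Now \<open>[z, g]\<close> lies in \<open>?D = ?Z\<close>, which has exponent
    \<open>p\<close> modulo \<open>?K\<close>; hence \<open>[z^p, g]\<close> is in \<open>?K\<close>
    and \<open>z^p\<close> in \<open>?Z = ?D\<close>.\<close>
  have "z [^] p \<in> ?D" if z: "z \<in> ?Y" for z
  proof -
    have zG: "z \<in> carrier G" using z by (simp add: rep_center_def)
    have "commutator G (z [^] p) g \<in> ?K" if g: "g \<in> carrier G" for g
    proof -
      have cz: "commutator G z g \<in> ?Z" using rep_center_commutator[OF rep\<psi> z g] ZeqD by simp
      then have "commutator G z g [^] p \<in> ?K" using FZ by blast
      then show ?thesis
        using rep_commutator_pow[OF rep zG g cz, of p] zG g by (simp add: rep_ker_def)
    qed
    then show ?thesis using rep_center_iff[OF irr, of "z [^] p"] zG ZeqD by simp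
  qed
  then have "card ?Y \<le> p * card ?D"
    using p_gt_1 irr_rep_pos[OF irr\<psi>] by (intro card_central_le[OF rep\<psi>]) auto
  then show False using bound by simp
qed

end

section \<open>Counting the steps of the series modulo each kernel\<close>

theorem theorem1p4:
  fixes G :: "('a, 'b) monoid_scheme" and p a b :: nat
  assumes "prime p"
    and "p_group p G"
    and "2 \<le> b" and "b < a"
    and "cod G = {1, real p, real p ^ b, real p ^ a}"
  shows "nilpotence_class G \<le> a + 1"
proof -
  obtain k where k: "group G" "finite (carrier G)" "card (carrier G) = p ^ k"
    using assms(2) by (auto simp: p_group_def)
  then interpret finite_p_group G p k
    using assms(1) by (intro finite_p_group.intro fin_group.intro fin_group_axioms.intro
      finite_p_group_axioms.intro)
  have cods: "\<exists>e \<in> {0, 1, b, a}. card (carrier G) = p ^ e * n * card (rep_ker G n \<rho>)"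
    if irr: "irr_rep G n \<rho>" for n \<rho>
  proof -
    have "character G \<rho> \<in> Irr G" using irr by (auto simp: Irr_def)
    then have "codegree G (character G \<rho>) \<in> {1, real p, real p ^ b, real p ^ a}"
      using assms(5) by (auto simp: cod_def)
    then obtain e where e: "e \<in> {0, 1, b, a}" "codegree G (character G \<rho>) = real p ^ e" by force
    have "card (rep_ker G n \<rho>) > 0" "n > 0"
      using card_normal_pos rep_ker_normal[OF irr_rep_is_rep[OF irr]] irr_rep_pos[OF irr] by auto
    then have "real (card (carrier G)) = real (p ^ e * n * card (rep_ker G n \<rho>))"
      using e(2) codegree_character[OF irr] by (simp add: field_simps)
    then show ?thesis using e(1) of_nat_eq_iff by blast
  qed
  have main: "rel_lcs G (rep_ker G n \<rho>) (a + 1) = rep_ker G n \<rho>" if irr: "irr_rep G n \<rho>" for n \<rho>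
  proof -
    let ?K = "rep_ker G n \<rho>"
    let ?L = "rel_lcs G ?K"
    have KN: "?K \<lhd> G" by (rule rep_ker_normal[OF irr_rep_is_rep[OF irr]])
    have stable: "?L (a + 1) = ?K" if "card (?L i) \<le> p ^ j * card ?K" "i + j \<le> a + 1" for i j
    proof -
      have "card (?L i) \<le> p ^ j * card ?K" by fact
      also have "\<dots> \<le> p ^ (a + 1 - i) * card ?K"
        using that(2) p_gt_1 by (intro mult_le_mono1 power_increasing) auto
      finally have "?L (i + (a + 1 - i)) = ?K" by (rule rel_lcs_reaches[OF KN])
      then show ?thesis using that(2) by simp
    qed
    show ?thesis
    proof (cases "?L 2 = ?K")
      case True
      then show ?thesis using stable[of 2 0] assms(3,4) by simp
    next
      case False
      have "?K \<noteq> carrier G"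
        using False rel_lcs_carrier[OF KN, of 2] subset_rel_lcs[OF KN, of 2] by blast
      obtain e where e: "e \<in> {0, 1, b, a}" "card (carrier G) = p ^ e * n * card ?K"
        using cods[OF irr] by blast
      have "card (carrier G) * p \<le> p ^ (2 * e) * card ?K"
        by (rule card_carrier_bound[OF irr \<open>?K \<noteq> carrier G\<close> e(2)])
      also have "\<dots> \<le> p ^ (2 * a) * card ?K"
        using e(1) assms(3,4) p_gt_1 by (intro mult_le_mono1 power_increasing) auto
      finally have small: "card (carrier G) * p \<le> p ^ (2 * a) * card ?K" .
      have "\<exists>d \<psi>. irr_rep G d \<psi> \<and> ?L 3 \<subseteq> rep_ker G d \<psi> \<and>
          card (carrier G) = p ^ a * d * card (rep_ker G d \<psi>)"
        using class_three_quotient_contradiction[OF KN False assms(3)] cods by (metis insert_iff)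
      then obtain d \<psi> where irr\<psi>: "irr_rep G d \<psi>" and L3: "?L 3 \<subseteq> rep_ker G d \<psi>"
        and cod\<psi>: "card (carrier G) = p ^ a * d * card (rep_ker G d \<psi>)" by blast
      note rep\<psi> = irr_rep_is_rep[OF irr\<psi>]
      have Dsub: "subgroup (rep_ker G d \<psi>) G"
        using rep_ker_normal[OF rep\<psi>] normal_imp_subgroup by blast
      have mono: "card (?L i) \<le> card (rep_ker G d \<psi>)" if "?L i \<subseteq> rep_ker G d \<psi>" for i
        using that finite_subgroup[OF Dsub] by (rule card_mono[rotated])
      \<comment> \<open>From \<open>|G : K| \<le> p^(2a - 1)\<close>: if \<open>l\<close> factors
        \<open>p\<close> are spent above \<open>?L i\<close>, at most \<open>j = 2a - 1 - l\<close>
        remain between \<open>?L i\<close> and \<open>?K\<close>.\<close>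
      have cancel: "card (?L i) \<le> p ^ j * card ?K"
        if "p ^ l * card (?L i) \<le> card (carrier G)" "l + 1 + j = 2 * a" for i j l
      proof -
        have "p ^ (l + 1) * card (?L i) \<le> card (carrier G) * p" using that(1) by (simp add: mult.commute)
        also have "\<dots> \<le> p ^ (l + 1 + j) * card ?K" using small that(2) by simp
        finally have "p ^ (l + 1) * card (?L i) \<le> p ^ (l + 1) * (p ^ j * card ?K)"
          by (simp only: power_add mult.assoc)
        then show ?thesis using p_gt_1 by simp
      qed
      show ?thesis
      proof (cases "d = 1")
        case True
        have "?L (Suc 0) \<subseteq> rep_ker G d \<psi>"
        proof (rule rel_lcs_Suc_least[OF Dsub])
          show "?K \<subseteq> rep_ker G d \<psi>" using subset_rel_lcs[OF KN, of 3] L3 by blast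
          show "commutator G h g \<in> rep_ker G d \<psi>" if "h \<in> ?L 0" "g \<in> carrier G" for h g
            using commutator_in_ker_degree_one[of \<psi> h g] rep\<psi> True that by simp
        qed
        then have "p ^ a * card (?L 1) \<le> card (carrier G)"
          using mono[of 1] cod\<psi> True by simp
        \<comment> \<open>Here \<open>l = a\<close>, and \<open>1 + (a - 1)\<close> steps are one
          fewer than allowed.\<close>
        then have "card (?L 1) \<le> p ^ (a - 1) * card ?K"
          using assms(3,4) by (intro cancel[where l = a]) auto
        then show ?thesis using stable[of 1 "a - 1"] assms(3,4) by simp
      next
        case False
        have "d dvd card (carrier G)" using cod\<psi> by simp
        then obtain i where i: "d = p ^ i" using dvd_card_carrier by blast
        then have "i \<noteq> 0" using False by (metis power_0)
        then have "p ^ 1 \<le> d" unfolding i using p_gt_1 by (intro power_increasing) auto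
        then have "p ^ a * p * card (?L 3) \<le> p ^ a * d * card (rep_ker G d \<psi>)"
          using mono[OF L3] by (intro mult_le_mono) auto
        then have "p ^ (a + 1) * card (?L 3) \<le> card (carrier G)" using cod\<psi> by (simp add: mult.commute)
        \<comment> \<open>The extra factor \<open>p\<close> from the degree gives
          \<open>l = a + 1\<close>, and \<open>3 + (a - 2)\<close> is exactly the bound
          \<open>a + 1\<close>.\<close>
        then have "card (?L 3) \<le> p ^ (a - 2) * card ?K"
          using assms(3,4) by (intro cancel[where l = "a + 1"]) auto
        then show ?thesis using stable[of 3 "a - 2"] assms(3,4) by simp
      qed
    qed
  qed
  \<comment> \<open>A nontrivial element of \<open>lcs G (a + 1)\<close> would survive in some
    irreducible representation, but this term lies in \<open>rel_lcs\<close> modulo every kernel and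
    so in every kernel.\<close>
  have "x = \<one>\<^bsub>G\<^esub>" if x: "x \<in> lcs G (a + 1)" for x
  proof (rule ccontr)
    assume "x \<noteq> \<one>\<^bsub>G\<^esub>"
    moreover have "x \<in> carrier G"
      using x lcs_subset_rel_lcs[of "a + 1" "{\<one>\<^bsub>G\<^esub>}"] rel_lcs_carrier[OF one_is_normal, of "a + 1"] by blast
    ultimately obtain n \<rho> where "irr_rep G n \<rho>" "x \<notin> rep_ker G n \<rho>"
      using separating_irr_rep[OF one_is_normal, of x] by blast
    then show False using main x lcs_subset_rel_lcs[of "a + 1" "rep_ker G n \<rho>"] by blast
  qed
  moreover have "\<one>\<^bsub>G\<^esub> \<in> lcs G (a + 1)" by (simp add: comm_subgroup_def generate.one)
  ultimately have "lcs G (a + 1) = {\<one>\<^bsub>G\<^esub>}" by blast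
  then show ?thesis unfolding nilpotence_class_def by (rule Least_le)
qed

end
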